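(* Let $J\subseteq\mathbb{R}$ be an interval, let $f:J\to(0,\infty)$ be a continuous log-convex function, and let $A,B,C,D\in\mathbb{B}(\mathscr{H})_h$ be operators with spectra contained in $J$ such that $A+D=B+C$, $A\le m\le B\le M\le D$ and $A\le m\le C\le M\le D$ for real numbers $m<M$. If $\Phi$ is a unital positive linear map on $\mathbb{B}(\mathscr{H})$, then \begin{align*} \Phi(f(B))+\Phi(f(C))&\le \Phi\left(K^{\widetilde{B}}f(m)^{\frac{M-B}{M-m}}f(M)^{\frac{B-m}{M-m}}\right)+\Phi\left(K^{\widetilde{C}}f(m)^{\frac{M-C}{M-m}}f(M)^{\frac{C-m}{M-m}}\right)\\ &\le \frac{2M-\Phi(B+C)}{M-m}f(m)+\frac{\Phi(B+C)-2m}{M-m}f(M)\\ &\le K^{\widetilde{\Phi(A)}}f(m)^{\frac{M-\Phi(A)}{M-m}}f(M)^{\frac{\Phi(A)-m}{M-m}}+K^{\widetilde{\Phi(D)}}f(m)^{\frac{M-\Phi(D)}{M-m}}f(M)^{\frac{\Phi(D)-m}{M-m}}\\ &\le f(\Phi(A))+f(\Phi(D)), \end{align*} where $K=K_f(m,M)=\dfrac{f\left(\frac{m+M}{2}\right)^2}{f(m)f(M)}$ and $\widetilde{t}=\frac12-\frac{1}{M-m}\left|t-\frac{m+M}{2}\right|$.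
   Context: $\mathscr{H}$ is a complex Hilbert space, $\mathbb{B}(\mathscr{H})$ is the algebra of bounded linear operators on $\mathscr{H}$ with identity $I$, and $\mathbb{B}(\mathscr{H})_h$ is its real subspace of self-adjoint operators. For self-adjoint $X,Y$, $X\le Y$ means that $Y-X$ is positive, i.e. $\langle (Y-X)x,x\rangle\ge 0$ for all $x$; a real number $c$ in an operator expression stands for $cI$. A linear map $\Phi:\mathbb{B}(\mathscr{H})\to\mathbb{B}(\mathscr{H})$ is positive if $\Phi(X)\ge0$ whenever $X\ge0$, and unital if $\Phi(I)=I$. A function $f:J\to(0,\infty)$ is log-convex if $\log f$ is convex, i.e. $f(\alpha x+(1-\alpha)y)\le f(x)^{\alpha}f(y)^{1-\alpha}$ for all $x,y\in J$, $\alpha\in[0,1]$. For self-adjoint $X$, all of $f(X)$, $\widetilde{X}=\frac12-\frac1{M-m}\left|X-\frac{m+M}{2}\right|$, and $K^{\widetilde{X}}f(m)^{\frac{M-X}{M-m}}f(M)^{\frac{X-m}{M-m}}$ are defined by the continuous functional calculus of $X$ (the last one is $g(X)$ for the scalar function $g(t)=K^{\widetilde{t}}f(m)^{\frac{M-t}{M-m}}f(M)^{\frac{t-m}{M-m}}$). *)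

theory Defs
  imports "HOL-Analysis.Analysis" "HOL-Computational_Algebra.Polynomial"
begin

section \<open>Complex Hilbert spaces\<close>

class complex_vector = real_vector +
  fixes scaleC :: "complex \<Rightarrow> 'a \<Rightarrow> 'a"  (infixr \<open>*\<^sub>C\<close> 75)
  assumes scaleC_add_right: "c *\<^sub>C (x + y) = c *\<^sub>C x + c *\<^sub>C y"
    and scaleC_add_left: "(c + d) *\<^sub>C x = c *\<^sub>C x + d *\<^sub>C x"
    and scaleC_scaleC: "c *\<^sub>C d *\<^sub>C x = (c * d) *\<^sub>C x"
    and scaleR_scaleC: "r *\<^sub>R x = complex_of_real r *\<^sub>C x"

lemma scaleC_one: "1 *\<^sub>C x = (x :: 'a :: complex_vector)"
  using scaleR_scaleC[of 1 x] by simp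

global_interpretation complex_vector: vector_space "scaleC :: complex \<Rightarrow> 'a \<Rightarrow> 'a :: complex_vector"
  by standard (simp_all add: scaleC_add_right scaleC_add_left scaleC_scaleC scaleC_one)

abbreviation clinear :: "('a :: complex_vector \<Rightarrow> 'b :: complex_vector) \<Rightarrow> bool"
  where "clinear \<equiv> Vector_Spaces.linear scaleC scaleC"

text \<open>The inner product is linear in its first argument. The last axiom also says that
  \<^term>\<open>cinner x x\<close> is real, nonnegative, and zero only for \<^term>\<open>x = 0\<close>.\<close>

class complex_inner = complex_vector + real_normed_vector +
  fixes cinner :: "'a \<Rightarrow> 'a \<Rightarrow> complex"
  assumes cinner_commute: "cinner x y = cnj (cinner y x)"
    and cinner_add_left: "cinner (x + y) z = cinner x z + cinner y z"
    and cinner_scaleC_left: "cinner (c *\<^sub>C x) y = c * cinner x y"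
    and cinner_self: "cinner x x = complex_of_real ((norm x)\<^sup>2)"

class chilbert_space = complex_inner + banach

lemma cinner_add_right: "cinner z (x + y) = cinner z x + cinner z (y :: 'a :: complex_inner)"
  by (metis cinner_add_left cinner_commute complex_cnj_add)

lemma cinner_scaleC_right: "cinner y (c *\<^sub>C x) = cnj c * cinner y (x :: 'a :: complex_inner)"
  by (metis cinner_scaleC_left cinner_commute complex_cnj_mult)

lemma cinner_zero_left [simp]: "cinner 0 (x :: 'a :: complex_inner) = 0"
  using cinner_add_left[of 0 0 x] by simp

lemma cinner_minus_left: "cinner (- x) y = - cinner x (y :: 'a :: complex_inner)"
  using cinner_add_left[of "- x" x y] by (simp add: eq_neg_iff_add_eq_0)

lemma norm_scaleC: "norm (c *\<^sub>C x) = cmod c * norm (x :: 'a :: complex_inner)"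
proof -
  have "complex_of_real ((norm (c *\<^sub>C x))\<^sup>2) = c * cnj c * complex_of_real ((norm x)\<^sup>2)"
    by (metis ab_semigroup_mult_class.mult_ac(1) cinner_scaleC_left cinner_scaleC_right cinner_self)
  also have "\<dots> = complex_of_real ((cmod c * norm x)\<^sup>2)"
    by (simp add: complex_norm_square power_mult_distrib del: of_real_power
        flip: of_real_mult) (simp add: complex_norm_square[symmetric] power_mult_distrib)
  finally have "(norm (c *\<^sub>C x))\<^sup>2 = (cmod c * norm x)\<^sup>2"
    by (simp only: of_real_eq_iff)
  then show ?thesis
    by (simp add: power2_eq_iff_nonneg)
qed

lemma bounded_linear_scaleC: "bounded_linear (\<lambda>x :: 'a :: complex_inner. c *\<^sub>C x)"
proof (rule bounded_linear_intro[of _ "cmod c"])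
  show "c *\<^sub>C r *\<^sub>R x = r *\<^sub>R c *\<^sub>C x" for r and x :: 'a
    by (simp add: scaleR_scaleC scaleC_scaleC mult.commute)
qed (simp_all add: scaleC_add_right norm_scaleC mult.commute)


section \<open>The algebra of bounded operators\<close>

lemma clinear_iff:
  "clinear f \<longleftrightarrow> (\<forall>x y. f (x + y) = f x + f y) \<and> (\<forall>c x. f (c *\<^sub>C x) = c *\<^sub>C f x)"
  by (simp add: Vector_Spaces.linear_iff complex_vector.vector_space_axioms)

lemma clinear_blinfun_iff:
  fixes T :: "'a :: complex_inner \<Rightarrow>\<^sub>L 'b :: complex_inner"
  shows "clinear (blinfun_apply T) \<longleftrightarrow> (\<forall>c x. T (c *\<^sub>C x) = c *\<^sub>C T x)"
  by (simp add: clinear_iff blinfun.add_right)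

typedef (overloaded) 'a bounded_op =
  "{T :: 'a :: complex_inner \<Rightarrow>\<^sub>L 'a. clinear (blinfun_apply T)}"
proof
  show "0 \<in> {T :: 'a \<Rightarrow>\<^sub>L 'a. clinear (blinfun_apply T)}"
    by (simp add: clinear_blinfun_iff)
qed

setup_lifting type_definition_bounded_op

lift_definition op_apply :: "'a :: complex_inner bounded_op \<Rightarrow> 'a \<Rightarrow> 'a" is blinfun_apply .

lemma op_eqI: "(\<And>x. op_apply S x = op_apply T x) \<Longrightarrow> S = T"
  by transfer (rule blinfun_eqI)

instantiation bounded_op :: (complex_inner) real_normed_vector
begin

lift_definition zero_bounded_op :: "'a bounded_op" is 0
  by (simp add: clinear_blinfun_iff)
lift_definition plus_bounded_op :: "'a bounded_op \<Rightarrow> 'a bounded_op \<Rightarrow> 'a bounded_op" is "(+)"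
  by (simp add: clinear_blinfun_iff blinfun.add_left scaleC_add_right)
lift_definition uminus_bounded_op :: "'a bounded_op \<Rightarrow> 'a bounded_op" is uminus
  by (simp add: clinear_blinfun_iff blinfun.minus_left)
lift_definition minus_bounded_op :: "'a bounded_op \<Rightarrow> 'a bounded_op \<Rightarrow> 'a bounded_op" is "(-)"
  by (simp add: clinear_blinfun_iff blinfun.diff_left complex_vector.scale_right_diff_distrib)
lift_definition scaleR_bounded_op :: "real \<Rightarrow> 'a bounded_op \<Rightarrow> 'a bounded_op" is scaleR
  by (simp add: clinear_blinfun_iff blinfun.scaleR_left scaleR_scaleC scaleC_scaleC mult.commute)
lift_definition norm_bounded_op :: "'a bounded_op \<Rightarrow> real" is norm .

definition sgn_bounded_op :: "'a bounded_op \<Rightarrow> 'a bounded_op"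
  where "sgn_bounded_op T = inverse (norm T) *\<^sub>R T"
definition dist_bounded_op :: "'a bounded_op \<Rightarrow> 'a bounded_op \<Rightarrow> real"
  where "dist_bounded_op S T = norm (S - T)"
definition [code del]: "(uniformity :: ('a bounded_op \<times> 'a bounded_op) filter) =
  (INF e\<in>{0 <..}. principal {(x, y). dist x y < e})"
definition open_bounded_op :: "'a bounded_op set \<Rightarrow> bool"
  where [code del]: "open_bounded_op S \<longleftrightarrow>
    (\<forall>x\<in>S. \<forall>\<^sub>F (x', y) in uniformity. x' = x \<longrightarrow> y \<in> S)"

instance
  by standard
    ((simp only: sgn_bounded_op_def dist_bounded_op_def uniformity_bounded_op_def
        open_bounded_op_def; fail)
    | (transfer, simp add: algebra_simps norm_triangle_ineq))+

end

instantiation bounded_op :: (complex_inner) complex_vector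
begin

lift_definition scaleC_bounded_op :: "complex \<Rightarrow> 'a bounded_op \<Rightarrow> 'a bounded_op"
  is "\<lambda>c T. Blinfun (\<lambda>x. c *\<^sub>C blinfun_apply T x)"
proof -
  fix c and T :: "'a \<Rightarrow>\<^sub>L 'a"
  assume T: "clinear (blinfun_apply T)"
  have "bounded_linear (\<lambda>x. c *\<^sub>C blinfun_apply T x)"
    by (rule bounded_linear_compose[OF bounded_linear_scaleC blinfun.bounded_linear_right])
  then show "clinear (blinfun_apply (Blinfun (\<lambda>x. c *\<^sub>C blinfun_apply T x)))"
    using T by (simp add: clinear_iff bounded_linear_Blinfun_apply scaleC_add_right scaleC_scaleC
        mult.commute)
qed

lemma op_apply_scaleC: "op_apply (c *\<^sub>C T) x = c *\<^sub>C op_apply T x"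
  by transfer (simp add: bounded_linear_Blinfun_apply
      bounded_linear_compose[OF bounded_linear_scaleC blinfun.bounded_linear_right])

instance
proof
  have add: "op_apply (S + T) x = op_apply S x + op_apply T x" for S T :: "'a bounded_op" and x
    by transfer (rule blinfun.add_left)
  have scaleR: "op_apply (r *\<^sub>R T) x = r *\<^sub>R op_apply T x" for r and T :: "'a bounded_op" and x
    by transfer (rule blinfun.scaleR_left)
  fix S T :: "'a bounded_op" and c d r
  show "c *\<^sub>C (S + T) = c *\<^sub>C S + c *\<^sub>C T"
    by (rule op_eqI) (simp add: add op_apply_scaleC scaleC_add_right)
  show "(c + d) *\<^sub>C T = c *\<^sub>C T + d *\<^sub>C T"
    by (rule op_eqI) (simp add: add op_apply_scaleC scaleC_add_left)
  show "c *\<^sub>C d *\<^sub>C T = (c * d) *\<^sub>C T"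
    by (rule op_eqI) (simp add: op_apply_scaleC scaleC_scaleC)
  show "r *\<^sub>R T = complex_of_real r *\<^sub>C T"
    by (rule op_eqI) (simp add: scaleR op_apply_scaleC scaleR_scaleC)
qed

end

instantiation bounded_op :: (complex_inner) "{real_normed_algebra, monoid_mult}"
begin

lift_definition one_bounded_op :: "'a bounded_op" is id_blinfun
  by (simp add: clinear_iff)
lift_definition times_bounded_op :: "'a bounded_op \<Rightarrow> 'a bounded_op \<Rightarrow> 'a bounded_op" is "(o\<^sub>L)"
  by (simp add: clinear_blinfun_iff)

instance
proof
  fix R S T :: "'a bounded_op" and r :: real
  show "R * S * T = R * (S * T)"
    by transfer (rule blinfun_eqI, simp)
  show "1 * T = T" "T * 1 = T"
    by (transfer, simp add: blinfun_eqI)+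
  show "(R + S) * T = R * T + S * T" "R * (S + T) = R * S + R * T"
    by (transfer, rule blinfun_eqI, simp add: blinfun.bilinear_simps)+
  show "r *\<^sub>R S * T = r *\<^sub>R (S * T)" "S * r *\<^sub>R T = r *\<^sub>R (S * T)"
    by (transfer, rule blinfun_eqI, simp add: blinfun.bilinear_simps)+
  show "norm (S * T) \<le> norm S * norm T"
    by transfer (rule norm_blinfun_compose)
qed

end

lemma op_apply_simps [simp]:
  fixes S T :: "'a :: complex_inner bounded_op"
  shows "op_apply 0 x = (0 :: 'a)"
    and "op_apply 1 x = (x :: 'a)"
    and "op_apply (S + T) x = op_apply S x + op_apply T x"
    and "op_apply (S - T) x = op_apply S x - op_apply T x"
    and "op_apply (- T) x = - op_apply T x"
    and "op_apply (r *\<^sub>R T) x = r *\<^sub>R op_apply T x"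
    and "op_apply (c *\<^sub>C T) x = c *\<^sub>C op_apply T x"
    and "op_apply (S * T) x = op_apply S (op_apply T x)"
  by (transfer; simp add: blinfun.bilinear_simps; fail | rule op_apply_scaleC)+

lemma op_apply_add: "op_apply T (x + y) = op_apply T x + op_apply T y"
  by transfer (rule blinfun.add_right)

lemma op_apply_scaleC_right: "op_apply T (c *\<^sub>C x) = c *\<^sub>C op_apply T x"
  by transfer (simp add: clinear_blinfun_iff)


section \<open>Self-adjointness, order and spectrum\<close>

definition selfadjoint :: "'a :: complex_inner bounded_op \<Rightarrow> bool"
  where "selfadjoint T \<longleftrightarrow> (\<forall>x y. cinner (op_apply T x) y = cinner x (op_apply T y))"

definition positive_op :: "'a :: complex_inner bounded_op \<Rightarrow> bool"
  where "positive_op T \<longleftrightarrow> (\<forall>x. cinner (op_apply T x) x \<in> \<real>\<^sub>\<ge>\<^sub>0)"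

lemma cinner_op_eq_0:
  fixes T :: "'a :: complex_inner bounded_op"
  assumes "\<And>x. cinner (op_apply T x) x = 0"
  shows "T = 0"
proof (rule op_eqI)
  fix x
  have 1: "cinner (op_apply T x) y + cinner (op_apply T y) x = 0" for y
    using assms[of "x + y"] assms[of x] assms[of y]
    by (simp add: op_apply_add cinner_add_left cinner_add_right add.commute)
  have 2: "cinner (op_apply T x) y = cinner (op_apply T y) x" for y
    using 1[of "\<i> *\<^sub>C y"]
    by (simp add: op_apply_scaleC_right cinner_scaleC_left cinner_scaleC_right)
  have "cinner (op_apply T x) (op_apply T x) = 0"
    using 1[of "op_apply T x"] 2[of "op_apply T x"] by simp
  then show "op_apply T x = op_apply 0 x"
    by (simp add: cinner_self)
qed

instantiation bounded_op :: (complex_inner) ordered_ab_group_add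
begin

definition less_eq_bounded_op :: "'a bounded_op \<Rightarrow> 'a bounded_op \<Rightarrow> bool"
  where "X \<le> Y \<longleftrightarrow> positive_op (Y - X)"
definition less_bounded_op :: "'a bounded_op \<Rightarrow> 'a bounded_op \<Rightarrow> bool"
  where "X < Y \<longleftrightarrow> X \<le> Y \<and> \<not> Y \<le> (X :: 'a bounded_op)"

instance
proof
  fix X Y Z :: "'a bounded_op"
  show "X < Y \<longleftrightarrow> X \<le> Y \<and> \<not> Y \<le> X"
    by (rule less_bounded_op_def)
  show "X \<le> X"
    by (simp add: less_eq_bounded_op_def positive_op_def)
  show "X \<le> Z" if "X \<le> Y" "Y \<le> Z"
  proof -
    have "cinner (op_apply (Z - X) x) x =
        cinner (op_apply (Z - Y) x) x + cinner (op_apply (Y - X) x) x" for x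
      by (simp flip: cinner_add_left)
    then show ?thesis
      using that unfolding less_eq_bounded_op_def positive_op_def
      by (metis nonneg_Reals_add_I)
  qed
  show "X = Y" if "X \<le> Y" "Y \<le> X"
  proof -
    have "cinner (op_apply (Y - X) x) x = 0" for x
    proof -
      have "op_apply (X - Y) x = - op_apply (Y - X) x"
        by simp
      then have "cinner (op_apply (X - Y) x) x = - cinner (op_apply (Y - X) x) x"
        by (metis cinner_minus_left)
      moreover have "cinner (op_apply (Y - X) x) x \<in> \<real>\<^sub>\<ge>\<^sub>0" "cinner (op_apply (X - Y) x) x \<in> \<real>\<^sub>\<ge>\<^sub>0"
        using that by (simp_all add: less_eq_bounded_op_def positive_op_def del: op_apply_simps)
      ultimately show ?thesis
        by (simp add: complex_nonneg_Reals_iff complex_eq_iff)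
    qed
    then have "Y - X = 0"
      by (rule cinner_op_eq_0)
    then show ?thesis
      by simp
  qed
  show "Z + X \<le> Z + Y" if "X \<le> Y"
    using that by (simp add: less_eq_bounded_op_def del: op_apply_simps)
qed

end

definition spectrum :: "'a :: complex_inner bounded_op \<Rightarrow> complex set"
  where "spectrum T = {z. \<not> (\<exists>S. S * (T - z *\<^sub>C 1) = 1 \<and> (T - z *\<^sub>C 1) * S = 1)}"


section \<open>Continuous functional calculus\<close>

definition op_poly :: "real poly \<Rightarrow> 'a :: complex_inner bounded_op \<Rightarrow> 'a bounded_op"
  where "op_poly p X = (\<Sum>i\<le>degree p. coeff p i *\<^sub>R X ^ i)"

text \<open>For self-adjoint \<open>X\<close> the spectrum is a compact set of reals and
  \<open>norm (op_poly p X)\<close> is the maximum of \<open>\<bar>p\<bar>\<close> on it. Hence, for \<open>f\<close> continuous on the spectrum,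
  the operators \<open>p\<^sub>n(X)\<close> converge in norm whenever the polynomials \<open>p\<^sub>n\<close> converge to \<open>f\<close> uniformly on
  the spectrum, and the limit, \<open>f(X)\<close>, does not depend on the sequence; such a sequence exists
  by the Weierstrass theorem. For other \<open>f\<close> or \<open>X\<close> the value of \<open>cfc f X\<close> carries no meaning.\<close>

definition cfc :: "(real \<Rightarrow> real) \<Rightarrow> 'a :: chilbert_space bounded_op \<Rightarrow> 'a bounded_op"
  where "cfc f X = (THE T. \<exists>p :: nat \<Rightarrow> real poly.
    uniform_limit {t. complex_of_real t \<in> spectrum X} (\<lambda>n. poly (p n)) f sequentially \<and>
    (\<lambda>n. op_poly (p n) X) \<longlonglongrightarrow> T)"


section \<open>Positive maps and log-convex functions\<close>

definition positive_map ::
    "('a :: complex_inner bounded_op \<Rightarrow> 'b :: complex_inner bounded_op) \<Rightarrow> bool"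
  where "positive_map \<Phi> \<longleftrightarrow> (\<forall>X. 0 \<le> X \<longrightarrow> 0 \<le> \<Phi> X)"

definition unital_map ::
    "('a :: complex_inner bounded_op \<Rightarrow> 'b :: complex_inner bounded_op) \<Rightarrow> bool"
  where "unital_map \<Phi> \<longleftrightarrow> \<Phi> 1 = 1"

definition log_convex_on :: "real set \<Rightarrow> (real \<Rightarrow> real) \<Rightarrow> bool"
  where "log_convex_on J f \<longleftrightarrow> (\<forall>x\<in>J. 0 < f x) \<and> convex_on J (\<lambda>x. ln (f x))"

definition K_const :: "(real \<Rightarrow> real) \<Rightarrow> real \<Rightarrow> real \<Rightarrow> real"
  where "K_const f m M = (f ((m + M) / 2))\<^sup>2 / (f m * f M)"

definition tilde :: "real \<Rightarrow> real \<Rightarrow> real \<Rightarrow> real"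
  where "tilde m M t = 1 / 2 - 1 / (M - m) * \<bar>t - (m + M) / 2\<bar>"

definition refined_interp :: "(real \<Rightarrow> real) \<Rightarrow> real \<Rightarrow> real \<Rightarrow> real \<Rightarrow> real"
  where "refined_interp f m M t =
    K_const f m M powr tilde m M t *
    f m powr ((M - t) / (M - m)) * f M powr ((t - m) / (M - m))"

end

theory Submission
  imports Defs "HOL-Computational_Algebra.Fundamental_Theorem_Algebra"
begin

text \<open>Write \<open>g\<close> for \<^term>\<open>refined_interp f m M\<close> and \<open>l\<close> for the chord of \<open>f\<close> through \<open>m\<close> and \<open>M\<close>.
  The theorem rests on two scalar chains of inequalities. The function \<open>ln \<circ> g\<close> interpolates the
  convex function \<open>ln \<circ> f\<close> at \<open>m\<close>, at the midpoint and at \<open>M\<close>, is affine on either side of the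
  midpoint, and differs from the chord of \<open>ln \<circ> f\<close> by \<^term>\<open>tilde m M t * ln (K_const f m M)\<close>, where
  the logarithm is nonpositive. Interpolation of a convex function lies above it and extrapolation
  lies below it; applied to \<open>ln \<circ> f\<close> and to \<open>exp\<close> this gives \<open>f \<le> g \<le> l\<close> on \<open>{m..M}\<close> and
  \<open>l \<le> g \<le> f\<close> on the rest of \<open>J\<close> (lemmas \<open>le_refined_interp\<close>, \<open>refined_interp_le_chord\<close>,
  \<open>chord_le_refined_interp\<close>, \<open>refined_interp_le\<close>).

  The functional calculus is monotone in the function (\<open>cfc_mono\<close>). The spectra of \<open>B\<close> and \<open>C\<close> lie in
  \<open>{m..M}\<close>, so \<open>f(B) \<le> g(B) \<le> l(B)\<close> and likewise for \<open>C\<close>; a positive map preserves this. The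
  spectrum of \<open>\<Phi>(A)\<close> lies to the left of \<open>m\<close> and that of \<open>\<Phi>(D)\<close> to the right of \<open>M\<close>, both
  between points of \<open>J\<close>, so \<open>l(\<Phi>(A)) \<le> g(\<Phi>(A)) \<le> f(\<Phi>(A))\<close> and likewise for \<open>D\<close>. The chains
  meet because \<open>l\<close> is affine, \<open>\<Phi>\<close> is linear and unital, and \<open>A + D = B + C\<close>.

  The spectral theory behind \<open>cfc_mono\<close> rests on one statement: a real polynomial \<open>p\<close> that is
  nonnegative on the spectrum of a self-adjoint \<open>X\<close> gives a positive operator \<open>p(X)\<close>
  (\<open>op_poly_nonneg\<close>). It follows from two facts. The bottom \<open>a\<close> of the numerical range of a
  self-adjoint operator lies in its spectrum, since a positive invertible operator is bounded below
  by a positive constant. And \<open>q(X)\<close> is invertible if \<open>q\<close> has no zero in the spectrum of \<open>X\<close>, by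
  factorization of \<open>q\<close> over the reals; applied to \<open>q = p - a\<close> this shows that \<open>a\<close> is a value of
  \<open>p\<close> on the spectrum.\<close>


section \<open>Quadratic forms of operators\<close>

text \<open>Since the norm is given together with the inner product, Cauchy-Schwarz is a reformulation of
  the triangle inequality.\<close>

lemma norm_add_squared:
  "(norm (x + y))\<^sup>2 = (norm x)\<^sup>2 + 2 * Re (cinner x y) + (norm (y :: 'a :: complex_inner))\<^sup>2"
proof -
  have "complex_of_real ((norm (x + y))\<^sup>2)
      = of_real ((norm x)\<^sup>2) + (cinner x y + cnj (cinner x y)) + of_real ((norm y)\<^sup>2)"
    unfolding cinner_self[symmetric] cinner_commute[of y x, symmetric]
    by (simp add: cinner_add_left cinner_add_right)
  then have "Re (complex_of_real ((norm (x + y))\<^sup>2))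
      = Re (of_real ((norm x)\<^sup>2) + (cinner x y + cnj (cinner x y)) + of_real ((norm y)\<^sup>2))"
    by (rule arg_cong)
  then show ?thesis
    by simp
qed

lemma cinner_minus_right: "cinner x (- y) = - cinner x (y :: 'a :: complex_inner)"
  by (metis cinner_commute cinner_minus_left complex_cnj_minus)

lemma cinner_scaleR_left: "cinner (r *\<^sub>R x) y = of_real r * cinner x (y :: 'a :: complex_inner)"
  by (simp add: scaleR_scaleC cinner_scaleC_left)

lemma cinner_scaleR_right: "cinner x (r *\<^sub>R y) = of_real r * cinner x (y :: 'a :: complex_inner)"
  by (simp add: scaleR_scaleC cinner_scaleC_right)

lemma abs_Re_cinner_le: "\<bar>Re (cinner x y)\<bar> \<le> norm x * norm (y :: 'a :: complex_inner)"
proof -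
  have *: "Re (cinner x z) \<le> norm x * norm z" for z :: 'a
  proof -
    have "(norm (x + z))\<^sup>2 \<le> (norm x + norm z)\<^sup>2"
      by (simp add: norm_triangle_ineq)
    then show ?thesis
      by (simp add: norm_add_squared power2_sum)
  qed
  show ?thesis
    using *[of y] *[of "- y"] by (simp add: cinner_minus_right)
qed

lemma cmod_cinner_le: "cmod (cinner x y) \<le> 2 * (norm x * norm (y :: 'a :: complex_inner))"
proof -
  have "\<bar>Im (cinner x y)\<bar> \<le> norm x * norm y"
    using abs_Re_cinner_le[of "\<i> *\<^sub>C x" y] by (simp add: cinner_scaleC_left norm_scaleC)
  then show ?thesis
    using cmod_le[of "cinner x y"] abs_Re_cinner_le[of x y] by linarith
qed

lemma op_apply_scaleR_right: "op_apply T (r *\<^sub>R x) = r *\<^sub>R op_apply T x"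
  by (simp add: scaleR_scaleC op_apply_scaleC_right)

lemma norm_op_apply: "norm (op_apply T x) \<le> norm T * norm x"
  by transfer (rule norm_blinfun)

lemma norm_op_le:
  assumes "0 \<le> c" "\<And>x. norm (op_apply T x) \<le> c * norm x"
  shows "norm T \<le> c"
  using assms by transfer (rule norm_blinfun_bound)

definition qform :: "'a :: complex_inner bounded_op \<Rightarrow> 'a \<Rightarrow> real"
  where "qform T x = Re (cinner (op_apply T x) x)"

lemma qform_simps [simp]:
  fixes S T :: "'a :: complex_inner bounded_op"
  shows "qform 0 x = 0" "qform 1 x = (norm x)\<^sup>2"
    and "qform (S + T) x = qform S x + qform T x"
    and "qform (- T) x = - qform T x"
    and "qform (S - T) x = qform S x - qform T x"
    and "qform (r *\<^sub>R T) x = r * qform T x"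
proof -
  show "qform (S - T) x = qform S x - qform T x"
    using cinner_add_left[of "op_apply S x" "- op_apply T x" x]
    by (simp add: qform_def cinner_minus_left)
qed (simp_all add: qform_def cinner_add_left cinner_minus_left cinner_self cinner_scaleR_left)

lemma abs_qform_le: "\<bar>qform T x\<bar> \<le> norm T * (norm x)\<^sup>2"
proof -
  have "\<bar>qform T x\<bar> \<le> norm (op_apply T x) * norm x"
    unfolding qform_def by (rule abs_Re_cinner_le)
  also have "\<dots> \<le> norm T * norm x * norm x"
    by (simp add: norm_op_apply mult_right_mono)
  finally show ?thesis
    by (simp add: power2_eq_square mult.assoc)
qed

lemma selfadjoint_simps [simp, intro]:
  fixes S T :: "'a :: complex_inner bounded_op"
  shows "selfadjoint (0 :: 'a bounded_op)" "selfadjoint (1 :: 'a bounded_op)"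
    and "selfadjoint S \<Longrightarrow> selfadjoint T \<Longrightarrow> selfadjoint (S + T)"
    and "selfadjoint T \<Longrightarrow> selfadjoint (- T)"
    and "selfadjoint S \<Longrightarrow> selfadjoint T \<Longrightarrow> selfadjoint (S - T)"
    and "selfadjoint T \<Longrightarrow> selfadjoint (r *\<^sub>R T)"
proof -
  show add: "selfadjoint (S + T)" if "selfadjoint S" "selfadjoint T" for S T :: "'a bounded_op"
    using that by (simp add: selfadjoint_def cinner_add_left cinner_add_right)
  show minus: "selfadjoint (- T)" if "selfadjoint T" for T :: "'a bounded_op"
    using that by (simp add: selfadjoint_def cinner_minus_left cinner_minus_right)
  show "selfadjoint (S - T)" if "selfadjoint S" "selfadjoint T"
    using add[OF that(1) minus[OF that(2)]] by simp
  show "selfadjoint (0 :: 'a bounded_op)"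
    using cinner_zero_left by (metis cinner_commute complex_cnj_zero op_apply_simps(1) selfadjoint_def)
qed (simp_all add: selfadjoint_def cinner_scaleR_left cinner_scaleR_right)

lemma selfadjoint_mult_commuting:
  "selfadjoint S \<Longrightarrow> selfadjoint T \<Longrightarrow> S * T = T * S \<Longrightarrow> selfadjoint (S * T)"
  by (metis op_apply_simps(8) selfadjoint_def)

lemma nonneg_op_iff: "0 \<le> T \<longleftrightarrow> selfadjoint T \<and> (\<forall>x. 0 \<le> qform T x)"
proof
  assume "selfadjoint T \<and> (\<forall>x. 0 \<le> qform T x)"
  moreover from this have "Im (cinner (op_apply T x) x) = 0" for x
    by (metis cinner_commute selfadjoint_def complex_cnj Im_complex_of_real
        complex_eq_cancel_iff2 cnj.sel(2) equal_neg_zero)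
  ultimately show "0 \<le> T"
    by (auto simp: less_eq_bounded_op_def positive_op_def complex_nonneg_Reals_iff qform_def)
next
  \<comment> \<open>Over the complex numbers, an operator whose quadratic form is real is self-adjoint:
    polarization at \<open>x + y\<close> and \<open>x + \<i> y\<close> gives the imaginary and the real part.\<close>
  assume "0 \<le> T"
  then have pos: "0 \<le> qform T x" "Im (cinner (op_apply T x) x) = 0" for x
    by (auto simp: less_eq_bounded_op_def positive_op_def complex_nonneg_Reals_iff qform_def)
  have sum: "Im (cinner (op_apply T x) y) + Im (cinner (op_apply T y) x) = 0" for x y
    using pos(2)[of "x + y"] pos(2)[of x] pos(2)[of y]
    by (simp add: op_apply_add cinner_add_left cinner_add_right)
  have "cinner (op_apply T x) y = cnj (cinner (op_apply T y) x)" for x y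
    using sum[of x y] sum[of x "\<i> *\<^sub>C y"]
    by (simp add: complex_eq_iff op_apply_scaleC_right cinner_scaleC_left cinner_scaleC_right)
  then have "selfadjoint T"
    by (simp add: selfadjoint_def flip: cinner_commute)
  with pos(1) show "selfadjoint T \<and> (\<forall>x. 0 \<le> qform T x)"
    by blast
qed

lemma le_op_iff: "S \<le> T \<longleftrightarrow> selfadjoint (T - S) \<and> (\<forall>x. qform S x \<le> qform T x)"
  using nonneg_op_iff[of "T - S"] by simp

instance bounded_op :: (complex_inner) ordered_real_vector
  by standard
    (auto simp: le_op_iff mult_left_mono mult_right_mono simp flip: scaleR_diff_right scaleR_diff_left)

text \<open>For fixed \<open>x\<close> the map \<open>T \<mapsto> \<langle>T x, x\<rangle>\<close> is continuous, and the nonnegative reals are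
  closed.\<close>

lemma nonneg_op_closed:
  assumes "\<And>n :: nat. 0 \<le> S n" "S \<longlonglongrightarrow> (T :: 'a :: complex_inner bounded_op)"
  shows "0 \<le> T"
proof -
  have "cinner (op_apply T x) x \<in> \<real>\<^sub>\<ge>\<^sub>0" for x
  proof -
    have "bounded_linear (\<lambda>T. cinner (op_apply T x) x)"
    proof (rule bounded_linear_intro)
      show "norm (cinner (op_apply T x) x) \<le> norm T * (2 * (norm x * norm x))" for T
      proof -
        have "norm (cinner (op_apply T x) x) \<le> 2 * (norm (op_apply T x) * norm x)"
          by (rule cmod_cinner_le)
        also have "\<dots> \<le> 2 * (norm T * norm x * norm x)"
          by (simp add: norm_op_apply mult_right_mono)
        finally show ?thesis
          by (simp add: ac_simps)
      qed
    qed (simp_all add: cinner_add_left cinner_scaleR_left scaleR_conv_of_real)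
    then have "(\<lambda>n. cinner (op_apply (S n) x) x) \<longlonglongrightarrow> cinner (op_apply T x) x"
      by (rule bounded_linear.tendsto) (rule assms)
    then show ?thesis
      by (rule closed_sequentially[OF closed_nonneg_Reals_complex, rotated])
        (use assms(1) in \<open>simp add: less_eq_bounded_op_def positive_op_def\<close>)
  qed
  then show ?thesis
    by (simp add: less_eq_bounded_op_def positive_op_def)
qed

lemma le_op_closed:
  assumes "\<And>n :: nat. S n \<le> T n" "S \<longlonglongrightarrow> S'" "T \<longlonglongrightarrow> (T' :: 'a :: complex_inner bounded_op)"
  shows "S' \<le> T'"
  using nonneg_op_closed[OF _ tendsto_diff[OF assms(3,2)]] assms(1) by simp

lemma selfadjoint_bounds:
  assumes "selfadjoint T"
  shows "T \<le> norm T *\<^sub>R 1" "- norm T *\<^sub>R 1 \<le> T"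
proof -
  have "qform T x \<le> norm T * (norm x)\<^sup>2" "- norm T * (norm x)\<^sup>2 \<le> qform T x" for x
    using abs_qform_le[of T x] by auto
  with assms show "T \<le> norm T *\<^sub>R 1" "- norm T *\<^sub>R 1 \<le> T"
    by (auto simp: le_op_iff)
qed

text \<open>Polarization expresses
  \<open>\<langle>T x, y\<rangle>\<close> through the quadratic form at \<open>x + y\<close> and \<open>x - y\<close>, and the parallelogram law bounds
  the result by \<open>s (\<parallel>x\<parallel>\<^sup>2 + \<parallel>y\<parallel>\<^sup>2) / 2\<close>; then \<open>y\<close> is taken in the direction of \<open>T x\<close> with the
  length of \<open>x\<close>.\<close>

lemma norm_selfadjoint_le:
  assumes "selfadjoint T" "0 \<le> s" "T \<le> s *\<^sub>R 1" "- (s *\<^sub>R 1) \<le> T"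
  shows "norm T \<le> s"
proof (rule norm_op_le[OF assms(2)])
  fix x
  have bound: "\<bar>qform T z\<bar> \<le> s * (norm z)\<^sup>2" for z
  proof -
    have "qform T z \<le> s * (norm z)\<^sup>2" "- (s * (norm z)\<^sup>2) \<le> qform T z"
      using assms(3,4) by (auto simp: le_op_iff)
    then show ?thesis
      by linarith
  qed
  have sym: "Re (cinner (op_apply T y) z) = Re (cinner (op_apply T z) y)" for y z
    using assms(1) by (metis cinner_commute cnj.sel(1) selfadjoint_def)
  have polar: "2 * Re (cinner (op_apply T x) y) \<le> s * ((norm x)\<^sup>2 + (norm y)\<^sup>2)" for y
  proof -
    have "qform T (x + y) = qform T x + 2 * Re (cinner (op_apply T x) y) + qform T y"
      using sym[of x y] by (simp add: qform_def op_apply_add cinner_add_left cinner_add_right)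
    moreover have "op_apply T (- y) = - op_apply T y"
      using op_apply_scaleC_right[of T "-1" y] by simp
    then have "qform T (x + - y) = qform T x - 2 * Re (cinner (op_apply T x) y) + qform T y"
      using sym[of x y]
      by (simp add: qform_def op_apply_add cinner_add_left cinner_add_right cinner_minus_left
          cinner_minus_right del: add_uminus_conv_diff)
    ultimately have "4 * Re (cinner (op_apply T x) y)
        \<le> s * (norm (x + y))\<^sup>2 + s * (norm (x + - y))\<^sup>2"
      using bound[of "x + y"] bound[of "x + - y"] by linarith
    also have "\<dots> = 2 * (s * ((norm x)\<^sup>2 + (norm y)\<^sup>2))"
      unfolding norm_add_squared by (simp add: cinner_minus_right algebra_simps)
    finally show ?thesis
      by simp
  qed
  show "norm (op_apply T x) \<le> s * norm x"
  proof (cases "op_apply T x = 0 \<or> x = 0")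
    case True
    then show ?thesis
      using assms(2) norm_op_apply[of T x] by auto
  next
    case False
    define r where "r = norm x / norm (op_apply T x)"
    have r: "r * norm (op_apply T x) = norm x" "0 \<le> r"
      using False by (simp_all add: r_def)
    have "2 * (r * (norm (op_apply T x))\<^sup>2) \<le> s * ((norm x)\<^sup>2 + (norm x)\<^sup>2)"
      using polar[of "r *\<^sub>R op_apply T x"] r
      by (simp add: cinner_scaleR_right cinner_self)
    moreover have "r * (norm (op_apply T x))\<^sup>2 = norm x * norm (op_apply T x)"
      using r(1) by (simp add: power2_eq_square flip: mult.assoc)
    ultimately have "norm x * norm (op_apply T x) \<le> norm x * (s * norm x)"
      unfolding power2_eq_square distrib_left by (simp add: ac_simps)
    then show ?thesis
      using False by simp
  qed
qed


section \<open>Invertibility of self-adjoint operators\<close>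

instance bounded_op :: (chilbert_space) banach
proof
  fix X :: "nat \<Rightarrow> 'a bounded_op"
  assume X: "Cauchy X"
  have dist: "dist (Rep_bounded_op S) (Rep_bounded_op T) = dist S T" for S T :: "'a bounded_op"
    unfolding dist_norm by transfer rule
  have "Cauchy (\<lambda>n. Rep_bounded_op (X n))"
    using X by (simp add: Cauchy_def dist)
  then obtain L where L: "(\<lambda>n. Rep_bounded_op (X n)) \<longlonglongrightarrow> L"
    using Cauchy_convergent_iff convergent_def by blast
  have lim: "(\<lambda>n. blinfun_apply (Rep_bounded_op (X n)) x) \<longlonglongrightarrow> blinfun_apply L x" for x
    using L by (rule bounded_linear.tendsto[OF blinfun.bounded_linear_left])
  have "blinfun_apply L (c *\<^sub>C x) = c *\<^sub>C blinfun_apply L x" for c x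
  proof (rule LIMSEQ_unique)
    show "(\<lambda>n. blinfun_apply (Rep_bounded_op (X n)) (c *\<^sub>C x)) \<longlonglongrightarrow> blinfun_apply L (c *\<^sub>C x)"
      by (rule lim)
    have "(\<lambda>n. c *\<^sub>C blinfun_apply (Rep_bounded_op (X n)) x) \<longlonglongrightarrow> c *\<^sub>C blinfun_apply L x"
      by (rule bounded_linear.tendsto[OF bounded_linear_scaleC lim])
    then show "(\<lambda>n. blinfun_apply (Rep_bounded_op (X n)) (c *\<^sub>C x)) \<longlonglongrightarrow> c *\<^sub>C blinfun_apply L x"
      using op_apply_scaleC_right[of "X _"] by (simp add: op_apply.rep_eq)
  qed
  then have "Rep_bounded_op (Abs_bounded_op L) = L"
    by (intro Abs_bounded_op_inverse) (simp add: clinear_blinfun_iff)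
  then have "X \<longlonglongrightarrow> Abs_bounded_op L"
    using L by (simp add: lim_sequentially flip: dist)
  then show "convergent X"
    by (rule convergentI)
qed

definition invertible_op :: "'a :: complex_inner bounded_op \<Rightarrow> bool"
  where "invertible_op T \<longleftrightarrow> (\<exists>S. S * T = 1 \<and> T * S = 1)"

lemma invertible_opI: "L * T = 1 \<Longrightarrow> T * R = 1 \<Longrightarrow> invertible_op T"
  unfolding invertible_op_def by (metis mult.assoc mult_1_left mult_1_right)

lemma invertible_op_mult:
  assumes "invertible_op S" "invertible_op T"
  shows "invertible_op (S * T)"
proof -
  obtain S' T' where "S' * S = 1" "S * S' = 1" "T' * T = 1" "T * T' = 1"
    using assms by (auto simp: invertible_op_def)
  then have "(T' * S') * (S * T) = 1" "(S * T) * (T' * S') = 1"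
    by (metis mult.assoc mult_1_left)+
  then show ?thesis
    by (rule invertible_opI)
qed

lemma invertible_op_scaleR:
  assumes "c \<noteq> 0" "invertible_op T"
  shows "invertible_op (c *\<^sub>R T)"
proof -
  obtain S where "S * T = 1" "T * S = 1"
    using assms(2) by (auto simp: invertible_op_def)
  then have "(inverse c *\<^sub>R S) * (c *\<^sub>R T) = 1" "(c *\<^sub>R T) * (inverse c *\<^sub>R S) = 1"
    using assms(1) by simp_all
  then show ?thesis
    by (rule invertible_opI)
qed

text \<open>If \<open>\<parallel>R\<parallel> < 1\<close>, then \<open>Z \<mapsto> 1 + R Z\<close> and \<open>Z \<mapsto> 1 + Z R\<close> are contractions of the Banach space of
  bounded operators, and their fixed points are one-sided inverses of \<open>1 - R\<close>.\<close>

lemma invertible_op_near_one: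
  fixes R :: "'a :: chilbert_space bounded_op"
  assumes "norm R < 1"
  shows "invertible_op (1 - R)"
proof -
  have "\<exists>!Z. 1 + R * Z = Z"
  proof (rule banach_fix_type[OF norm_ge_zero assms], intro allI)
    fix Y Z
    have "norm (R * (Y - Z)) \<le> norm R * norm (Y - Z)"
      by (rule norm_mult_ineq)
    then show "dist (1 + R * Y) (1 + R * Z) \<le> norm R * dist Y Z"
      by (simp add: dist_norm right_diff_distrib)
  qed
  moreover have "\<exists>!Z. 1 + Z * R = Z"
  proof (rule banach_fix_type[OF norm_ge_zero assms], intro allI)
    fix Y Z
    have "norm ((Y - Z) * R) \<le> norm (Y - Z) * norm R"
      by (rule norm_mult_ineq)
    then show "dist (1 + Y * R) (1 + Z * R) \<le> norm R * dist Y Z"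
      by (simp add: dist_norm left_diff_distrib mult.commute)
  qed
  ultimately obtain Y Z where "1 + R * Y = Y" "1 + Z * R = Z"
    by blast
  then have "Z * (1 - R) = 1" "(1 - R) * Y = 1"
    by (simp_all add: algebra_simps)
  then show ?thesis
    by (rule invertible_opI)
qed

text \<open>A self-adjoint operator between \<open>c > 0\<close> and \<open>k\<close> becomes close to the identity when it is
  divided by \<open>k\<close>: the difference lies between \<open>0\<close> and \<open>1 - c / k\<close>.\<close>

lemma invertible_op_coercive:
  fixes T :: "'a :: chilbert_space bounded_op"
  assumes "selfadjoint T" "0 < c" "c *\<^sub>R 1 \<le> T"
  shows "invertible_op T"
proof -
  define k where "k = norm T + c"
  define R where "R = 1 - (1 / k) *\<^sub>R T"
  have k: "0 < k" "c \<le> k"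
    using assms(2) by (simp_all add: k_def add_nonneg_pos)
  have q: "c * (norm x)\<^sup>2 \<le> qform T x" "qform T x \<le> k * (norm x)\<^sup>2" for x
  proof -
    show "c * (norm x)\<^sup>2 \<le> qform T x"
      using assms(3) by (simp add: le_op_iff)
    have "qform T x \<le> norm T * (norm x)\<^sup>2" "0 \<le> c * (norm x)\<^sup>2"
      using abs_qform_le[of T x] assms(2) by simp_all
    then show "qform T x \<le> k * (norm x)\<^sup>2"
      unfolding k_def distrib_right by linarith
  qed
  have "norm R \<le> 1 - c / k"
  proof (rule norm_selfadjoint_le)
    show "selfadjoint R"
      using assms(1) by (simp add: R_def selfadjoint_simps)
    show c: "0 \<le> 1 - c / k"
      using k by simp
    have "(c / k) * (norm x)\<^sup>2 \<le> qform T x / k" "qform T x / k \<le> (norm x)\<^sup>2" for x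
      using q[of x] k(1) by (simp_all add: field_simps)
    then have "qform R x \<le> (1 - c / k) * (norm x)\<^sup>2" "0 \<le> qform R x" for x
      by (simp_all add: R_def left_diff_distrib)
    moreover have "0 \<le> (1 - c / k) * (norm x)\<^sup>2" for x :: 'a
      using c by simp
    ultimately have "qform R x \<le> (1 - c / k) * (norm x)\<^sup>2" "- ((1 - c / k) * (norm x)\<^sup>2) \<le> qform R x"
      for x
      by (simp, metis neg_le_0_iff_le order_trans)
    then show "R \<le> (1 - c / k) *\<^sub>R 1" "- ((1 - c / k) *\<^sub>R 1) \<le> R"
      using \<open>selfadjoint R\<close> by (auto simp: le_op_iff selfadjoint_simps)
  qed
  also have "\<dots> < 1"
    using k(1) assms(2) by simp
  finally have "invertible_op (k *\<^sub>R (1 - R))"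
    using k(1) by (intro invertible_op_scaleR invertible_op_near_one) auto
  then show ?thesis
    using k(1) by (simp add: R_def)
qed

text \<open>A converse to the preceding lemma. With \<open>k > \<parallel>T\<parallel>\<close>, positivity at
  \<open>x - T x / k\<close> gives \<open>\<parallel>T x\<parallel>\<^sup>2 \<le> k \<langle>T x, x\<rangle>\<close>, and the inverse bounds \<open>\<parallel>x\<parallel>\<close> by a multiple
  of \<open>\<parallel>T x\<parallel>\<close>.\<close>

lemma coercive_if_invertible_op:
  fixes T :: "'a :: complex_inner bounded_op"
  assumes "0 \<le> T" "invertible_op T"
  obtains d where "0 < d" "d *\<^sub>R 1 \<le> T"
proof -
  have T: "selfadjoint T" "0 \<le> qform T x" for x
    using assms(1) by (auto simp: nonneg_op_iff)
  define k where "k = norm T + 1"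
  have k: "0 < k"
    by (simp add: k_def add_nonneg_pos)
  have lower: "(norm (op_apply T x))\<^sup>2 \<le> k * qform T x" for x
  proof -
    define u where "u = op_apply T x"
    have "cinner (op_apply T u) x = cinner u u"
      using T(1) by (simp add: selfadjoint_def u_def)
    moreover have "op_apply T (x + (- (1 / k)) *\<^sub>R u) = u + (- (1 / k)) *\<^sub>R op_apply T u"
      by (simp add: op_apply_add op_apply_scaleR_right flip: u_def del: scaleR_minus_left)
    ultimately have "qform T (x + (- (1 / k)) *\<^sub>R u)
        = qform T x - 2 / k * (norm u)\<^sup>2 + (1 / k)\<^sup>2 * qform T u"
      by (simp add: qform_def cinner_add_left cinner_add_right cinner_scaleR_left
          cinner_scaleR_right cinner_self flip: u_def del: scaleR_minus_left)
        (simp add: power2_eq_square right_diff_distrib diff_divide_distrib)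
    moreover have "qform T u \<le> k * (norm u)\<^sup>2"
    proof -
      have "qform T u \<le> norm T * (norm u)\<^sup>2"
        using abs_qform_le[of T u] by simp
      then show ?thesis
        using zero_le_power2[of "norm u"] unfolding k_def distrib_right by linarith
    qed
    then have "(1 / k)\<^sup>2 * qform T u \<le> (1 / k)\<^sup>2 * (k * (norm u)\<^sup>2)"
      by (rule mult_left_mono) simp
    moreover have "(1 / k)\<^sup>2 * (k * (norm u)\<^sup>2) = 1 / k * (norm u)\<^sup>2"
      using k by (simp add: power2_eq_square)
    ultimately have "1 / k * (norm u)\<^sup>2 \<le> qform T x"
      using T(2)[of "x + (- (1 / k)) *\<^sub>R u"] by (simp add: field_simps)
    then show ?thesis
      using k by (simp add: u_def field_simps)
  qed
  obtain S where S: "S * T = 1"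
    using assms(2) by (auto simp: invertible_op_def)
  define b where "b = (norm S)\<^sup>2 * k + 1"
  have b: "0 < b"
    using k by (simp add: b_def add_nonneg_pos)
  have "(norm x)\<^sup>2 \<le> b * qform T x" for x
  proof -
    have "x = op_apply S (op_apply T x)"
      using S by (metis op_apply_simps(2,8))
    then have "norm x \<le> norm S * norm (op_apply T x)"
      by (metis norm_op_apply)
    then have "(norm x)\<^sup>2 \<le> (norm S * norm (op_apply T x))\<^sup>2"
      by (simp add: power_mono)
    also have "\<dots> = (norm S)\<^sup>2 * (norm (op_apply T x))\<^sup>2"
      by (rule power_mult_distrib)
    also have "\<dots> \<le> (norm S)\<^sup>2 * (k * qform T x)"
      by (rule mult_left_mono[OF lower]) simp
    also have "\<dots> \<le> b * qform T x"
      using T(2)[of x] by (simp add: b_def distrib_right mult.assoc)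
    finally show ?thesis .
  qed
  then have "(1 / b) *\<^sub>R 1 \<le> T"
    using T(1) b by (simp add: le_op_iff field_simps selfadjoint_simps)
  then show ?thesis
    using that[of "1 / b"] b by simp
qed


section \<open>Real spectrum and polynomials\<close>

definition real_spectrum :: "'a :: complex_inner bounded_op \<Rightarrow> real set"
  where "real_spectrum X = {t. complex_of_real t \<in> spectrum X}"

lemma in_real_spectrum_iff: "t \<in> real_spectrum X \<longleftrightarrow> \<not> invertible_op (X - t *\<^sub>R 1)"
  by (simp add: real_spectrum_def spectrum_def invertible_op_def scaleR_scaleC)

lemma real_spectrum_subset:
  assumes "spectrum X \<subseteq> complex_of_real ` J"
  shows "real_spectrum X \<subseteq> J"
  using assms by (auto simp: real_spectrum_def)

lemma real_spectrum_uminus: "real_spectrum (- X) = uminus ` real_spectrum X"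
proof -
  have "invertible_op (- X - t *\<^sub>R 1) \<longleftrightarrow> invertible_op (X - (- t) *\<^sub>R 1)" for t
  proof -
    have "- X - t *\<^sub>R 1 = (-1) *\<^sub>R (X - (- t) *\<^sub>R 1)" "X - (- t) *\<^sub>R 1 = (-1) *\<^sub>R (- X - t *\<^sub>R 1)"
      by simp_all
    then show ?thesis
      by (metis invertible_op_scaleR neg_equal_0_iff_equal zero_neq_one)
  qed
  then have "t \<in> real_spectrum (- X) \<longleftrightarrow> - t \<in> real_spectrum X" for t
    by (simp add: in_real_spectrum_iff)
  then show ?thesis
    by (force simp: image_iff)
qed

lemma real_spectrum_ge:
  fixes X :: "'a :: chilbert_space bounded_op"
  assumes "selfadjoint X" "a *\<^sub>R 1 \<le> X"
  shows "real_spectrum X \<subseteq> {a..}"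
proof
  fix t
  assume "t \<in> real_spectrum X"
  then have *: "\<not> invertible_op (X - t *\<^sub>R 1)"
    by (simp add: in_real_spectrum_iff)
  show "t \<in> {a..}"
  proof (rule ccontr)
    assume "t \<notin> {a..}"
    moreover have "(a - t) *\<^sub>R 1 \<le> X - t *\<^sub>R 1"
      using assms(2) by (simp add: scaleR_left_diff_distrib)
    ultimately show False
      using * assms(1) invertible_op_coercive[of "X - t *\<^sub>R 1" "a - t"] by (simp add: selfadjoint_simps)
  qed
qed

lemma real_spectrum_le:
  fixes X :: "'a :: chilbert_space bounded_op"
  assumes "selfadjoint X" "X \<le> b *\<^sub>R 1"
  shows "real_spectrum X \<subseteq> {..b}"
  using real_spectrum_ge[of "- X" "- b"] assms by (auto simp: real_spectrum_uminus selfadjoint_simps)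

text \<open>Let \<open>a\<close> be the largest number with \<open>a \<le> X\<close>, the bottom of the numerical range. If
  \<open>X - a\<close> were invertible, it would be coercive and \<open>a\<close> would not be the largest such number; so
  \<open>a\<close> lies in the spectrum. The hypothesis \<open>1 \<noteq> 0\<close> excludes the zero space, where every \<open>a\<close>
  satisfies \<open>a \<le> X\<close> and the spectrum is empty.\<close>

lemma real_spectrum_lower:
  fixes X :: "'a :: chilbert_space bounded_op"
  assumes X: "selfadjoint X" and nontrivial: "(1 :: 'a bounded_op) \<noteq> 0"
  obtains a where "a \<in> real_spectrum X" "a *\<^sub>R 1 \<le> X"
proof -
  define S where "S = {a. a *\<^sub>R 1 \<le> X}"
  have one: "(0 :: 'a bounded_op) \<le> 1"
    by (simp add: nonneg_op_iff)
  have "- norm X \<in> S"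
    using selfadjoint_bounds(2)[OF X] by (simp add: S_def)
  then have ne: "S \<noteq> {}"
    by blast
  have "a \<le> norm X" if "a \<in> S" for a
  proof (rule ccontr)
    assume a: "\<not> a \<le> norm X"
    have "a *\<^sub>R 1 \<le> norm X *\<^sub>R (1 :: 'a bounded_op)"
      using that selfadjoint_bounds(1)[OF X] by (auto simp: S_def intro: order_trans)
    then have "(a - norm X) *\<^sub>R 1 \<le> (0 :: 'a bounded_op)"
      by (simp add: scaleR_left_diff_distrib)
    moreover have "0 \<le> (a - norm X) *\<^sub>R (1 :: 'a bounded_op)"
      using a one by (intro scaleR_nonneg_nonneg) auto
    ultimately have "(a - norm X) *\<^sub>R (1 :: 'a bounded_op) = 0"
      by (rule antisym)
    with a nontrivial show False
      by simp
  qed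
  then have bdd: "bdd_above S"
    by (rule bdd_aboveI)
  define a where "a = Sup S"
  have "a *\<^sub>R 1 \<le> X"
  proof (rule le_op_closed)
    show "(a - inverse (real (Suc n))) *\<^sub>R 1 \<le> X" for n
    proof -
      have "a - inverse (real (Suc n)) < Sup S"
        by (simp add: a_def)
      then obtain b where "b \<in> S" "a - inverse (real (Suc n)) < b"
        using less_cSup_iff[OF ne bdd] by blast
      then have "(a - inverse (real (Suc n))) *\<^sub>R 1 \<le> b *\<^sub>R (1 :: 'a bounded_op)" "b *\<^sub>R 1 \<le> X"
        using one by (auto simp: S_def intro: scaleR_right_mono)
      then show ?thesis
        by (rule order_trans)
    qed
    have "(\<lambda>n. a - inverse (real (Suc n))) \<longlonglongrightarrow> a - 0"
      by (intro tendsto_diff tendsto_const LIMSEQ_inverse_real_of_nat)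
    then show "(\<lambda>n. (a - inverse (real (Suc n))) *\<^sub>R 1) \<longlonglongrightarrow> a *\<^sub>R (1 :: 'a bounded_op)"
      by (intro tendsto_scaleR tendsto_const) simp
  qed (rule tendsto_const)
  moreover have "a \<in> real_spectrum X"
  proof (rule ccontr)
    assume "a \<notin> real_spectrum X"
    then have "invertible_op (X - a *\<^sub>R 1)"
      by (simp add: in_real_spectrum_iff)
    moreover have "0 \<le> X - a *\<^sub>R 1"
      using \<open>a *\<^sub>R 1 \<le> X\<close> by simp
    ultimately obtain d where d: "0 < d" "d *\<^sub>R 1 \<le> X - a *\<^sub>R 1"
      by (metis coercive_if_invertible_op)
    then have "d + a \<in> S"
      by (simp add: S_def scaleR_left_distrib le_diff_eq)
    then have "d + a \<le> a"
      unfolding a_def using bdd by (rule cSup_upper)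
    with d(1) show False
      by simp
  qed
  ultimately show ?thesis
    using that by blast
qed

lemma real_spectrum_upper:
  fixes X :: "'a :: chilbert_space bounded_op"
  assumes X: "selfadjoint X" and nontrivial: "(1 :: 'a bounded_op) \<noteq> 0"
  obtains b where "b \<in> real_spectrum X" "X \<le> b *\<^sub>R 1"
proof -
  obtain a where "a \<in> real_spectrum (- X)" "a *\<^sub>R 1 \<le> - X"
    using real_spectrum_lower[of "- X"] assms by (auto simp: selfadjoint_simps)
  then have "- a \<in> real_spectrum X" "X \<le> (- a) *\<^sub>R 1"
    by (auto simp: real_spectrum_uminus)
  then show ?thesis
    by (rule that)
qed

lemma op_poly_eq_sum:
  assumes "degree p \<le> n"
  shows "op_poly p X = (\<Sum>i\<le>n. coeff p i *\<^sub>R X ^ i)"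
  unfolding op_poly_def using assms
  by (intro sum.mono_neutral_left) (auto simp: coeff_eq_0)

lemma op_poly_0 [simp]: "op_poly 0 X = 0"
  by (simp add: op_poly_def)

lemma op_poly_pCons [simp]: "op_poly (pCons a p) X = a *\<^sub>R 1 + X * op_poly p X"
proof -
  have "op_poly (pCons a p) X = (\<Sum>i\<le>Suc (degree p). coeff (pCons a p) i *\<^sub>R X ^ i)"
    by (rule op_poly_eq_sum) (rule degree_pCons_le)
  also have "\<dots> = a *\<^sub>R 1 + (\<Sum>i\<le>degree p. X * (coeff p i *\<^sub>R X ^ i))"
    unfolding sum.atMost_Suc_shift by simp
  finally show ?thesis
    by (simp add: op_poly_def sum_distrib_left)
qed

lemma op_poly_add [simp]: "op_poly (p + q) X = op_poly p X + op_poly q X"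
proof (induction p q rule: poly_induct2)
  case (pCons a p b q)
  then show ?case
    by (simp add: algebra_simps)
qed simp

lemma op_poly_smult [simp]: "op_poly (smult c p) X = c *\<^sub>R op_poly p X"
  by (induction p) (simp_all add: scaleR_right_distrib)

lemma op_poly_diff [simp]: "op_poly (p - q) X = op_poly p X - op_poly q X"
  using op_poly_add[of p "smult (- 1) q" X] unfolding op_poly_smult by simp

lemma op_poly_mult [simp]: "op_poly (p * q) X = op_poly p X * op_poly q X"
  by (induction p) (simp_all add: algebra_simps)

lemma op_poly_commute: "op_poly p X * X = X * op_poly p X"
  by (induction p) (simp_all add: algebra_simps)

lemma selfadjoint_op_poly:
  assumes "selfadjoint X"
  shows "selfadjoint (op_poly p X)"
proof (induction p)
  case (pCons a p)
  then show ?case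
    using assms
    by (auto simp: op_poly_commute intro!: selfadjoint_simps selfadjoint_mult_commuting)
qed simp

lemma poly_of_real:
  "poly (map_poly complex_of_real p) (of_real x) = of_real (poly p x)"
  by (induction p) (simp_all add: map_poly_pCons)

lemma poly_of_real_add:
  "poly (map_poly complex_of_real (p + q)) z
    = poly (map_poly of_real p) z + poly (map_poly of_real q) z"
  by (induction p q rule: poly_induct2) (simp_all add: map_poly_pCons distrib_left)

lemma poly_of_real_mult:
  "poly (map_poly complex_of_real (p * q)) z
    = poly (map_poly of_real p) z * poly (map_poly of_real q) z"
  by (induction p)
    (simp_all add: map_poly_pCons poly_of_real_add map_poly_smult distrib_right mult.assoc)

text \<open>A complex root \<open>a + i b\<close> exists by the fundamental theorem of algebra. If it is not real, its
  minimal polynomial over the reals is \<open>(x - a)\<^sup>2 + b\<^sup>2\<close>.\<close>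

lemma real_poly_factor_cases:
  fixes q :: "real poly"
  assumes "degree q \<noteq> 0"
  obtains (real) a where "poly q a = 0" "[:- a, 1:] dvd q"
    | (complex) a b where "b \<noteq> 0" "[:- a, 1:] * [:- a, 1:] + [:b\<^sup>2:] dvd q"
proof -
  define qc where "qc = map_poly complex_of_real q"
  have "degree qc \<noteq> 0"
    using assms by (simp add: qc_def degree_map_poly)
  then have "\<not> constant (poly qc)"
    by (simp add: constant_degree)
  then obtain z where z: "poly qc z = 0"
    using fundamental_theorem_of_algebra by blast
  define a b where "a = Re z" and "b = Im z"
  have z_eq: "z = Complex a b"
    by (simp add: a_def b_def)
  show ?thesis
  proof (cases "b = 0")
    case True
    then have "z = complex_of_real a"
      by (simp add: z_eq complex_of_real_def)
    with z have "poly q a = 0"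
      by (simp add: qc_def poly_of_real)
    then show ?thesis
      using real by (simp add: poly_eq_0_iff_dvd)
  next
    case False
    define d where "d = [:- a, 1:] * [:- a, 1:] + [:b\<^sup>2:]"
    have d_eq: "d = [:a * a + b\<^sup>2, - 2 * a, 1:]"
      by (simp add: d_def)
    \<comment> \<open>The remainder is at most linear with real coefficients and vanishes at the nonreal \<open>z\<close>.\<close>
    define r where "r = q mod d"
    have "degree r < 2 \<or> r = 0"
      using degree_mod_less[of d q] by (auto simp: r_def d_eq)
    then have "coeff r i = 0" if "2 \<le> i" for i
      using that by (auto intro: coeff_eq_0)
    then have "r = [:coeff r 0, coeff r 1:]"
      by (intro poly_eqI) (auto simp: coeff_pCons numeral_2_eq_2 split: nat.splits)
    then obtain u v where r: "r = [:u, v:]"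
      by blast
    have "map_poly complex_of_real (d * (q div d) + r) = qc"
      by (simp add: r_def qc_def)
    then have "poly (map_poly complex_of_real d) z * poly (map_poly complex_of_real (q div d)) z
        + poly (map_poly complex_of_real r) z = 0"
      using z by (simp flip: poly_of_real_mult poly_of_real_add)
    moreover have "poly (map_poly complex_of_real d) z = 0"
      by (simp add: d_eq z_eq map_poly_pCons complex_eq_iff power2_eq_square algebra_simps)
    ultimately have "complex_of_real u + z * complex_of_real v = 0"
      by (simp add: r map_poly_pCons)
    then have "u = 0" "v = 0"
      using False by (auto simp: z_eq complex_eq_iff)
    then have "d dvd q"
      using r by (simp add: r_def dvd_eq_mod_eq_0)
    then show ?thesis
      using complex False by (simp add: d_def)
  qed
qed

text \<open>The factorization reduces the claim to linear factors \<open>X - a\<close>, where \<open>a\<close> is not in the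
  spectrum, and quadratic factors \<open>(X - a)\<^sup>2 + b\<^sup>2\<close>, which are coercive.\<close>

lemma invertible_op_poly:
  fixes X :: "'a :: chilbert_space bounded_op"
  assumes X: "selfadjoint X" and q: "\<And>t. t \<in> real_spectrum X \<Longrightarrow> poly q t \<noteq> 0"
  shows "invertible_op (op_poly q X)"
  using q
proof (induction "degree q" arbitrary: q rule: less_induct)
  case less
  show ?case
  proof (cases "degree q = 0")
    case True
    then obtain c where c: "q = [:c:]"
      by (rule degree_eq_zeroE)
    show ?thesis
    proof (cases "c = 0")
      case True
      \<comment> \<open>A vanishing \<open>q\<close> leaves room only for an empty spectrum, hence for the zero space.\<close>
      then have "real_spectrum X = {}"
        using less.prems c by auto
      then have "(1 :: 'a bounded_op) = 0"
        using real_spectrum_lower[OF X] by blast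
      then have "0 * op_poly q X = 1" "op_poly q X * 0 = 1"
        by simp_all
      then show ?thesis
        by (rule invertible_opI)
    next
      case False
      have "invertible_op (1 :: 'a bounded_op)"
        by (rule invertible_opI[of 1 _ 1]) simp_all
      then show ?thesis
        using False by (simp add: c invertible_op_scaleR)
    qed
  next
    case False
    have factor: "invertible_op (op_poly q X)"
      if d: "d dvd q" "degree d > 0" "invertible_op (op_poly d X)" for d
    proof -
      obtain p where p: "q = d * p"
        using d(1) by (rule dvdE)
      with False have "p \<noteq> 0" "d \<noteq> 0"
        by auto
      then have "degree p < degree q"
        using d(2) by (simp add: p degree_mult_eq)
      then have "invertible_op (op_poly p X)"
        using less.hyps[of p] less.prems by (simp add: p)
      then show ?thesis
        using d(3) by (simp add: p invertible_op_mult)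
    qed
    from False show ?thesis
    proof (cases rule: real_poly_factor_cases)
      case (real a)
      then have "a \<notin> real_spectrum X"
        using less.prems by blast
      then have "invertible_op (op_poly [:- a, 1:] X)"
        by (simp add: in_real_spectrum_iff)
      then show ?thesis
        using factor[OF real(2)] by simp
    next
      case (complex a b)
      define Y where "Y = X - a *\<^sub>R 1"
      have Y: "selfadjoint Y"
        using X by (simp add: Y_def selfadjoint_simps)
      have "qform (Y * Y) x = (norm (op_apply Y x))\<^sup>2" for x
        using Y by (simp add: qform_def selfadjoint_def cinner_self)
      then have "b\<^sup>2 *\<^sub>R 1 \<le> Y * Y + b\<^sup>2 *\<^sub>R 1"
        using Y by (auto simp: le_op_iff intro: selfadjoint_mult_commuting)
      moreover have "selfadjoint (Y * Y + b\<^sup>2 *\<^sub>R 1)"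
        using Y by (intro selfadjoint_simps selfadjoint_mult_commuting) auto
      ultimately have "invertible_op (Y * Y + b\<^sup>2 *\<^sub>R 1)"
        using complex(1) by (intro invertible_op_coercive[of _ "b\<^sup>2"]) auto
      moreover have "op_poly ([:- a, 1:] * [:- a, 1:] + [:b\<^sup>2:]) X = Y * Y + b\<^sup>2 *\<^sub>R 1"
        unfolding op_poly_add op_poly_mult by (simp add: Y_def)
      moreover have "degree ([:- a, 1:] * [:- a, 1:] + [:b\<^sup>2:]) > 0"
        by simp
      ultimately show ?thesis
        using factor[OF complex(2)] by metis
    qed
  qed
qed

text \<open>The bottom \<open>a\<close> of the numerical range of \<open>p(X)\<close> lies in the spectrum of \<open>p(X)\<close>. Since
  \<open>p(X) - a\<close> is not invertible, \<open>p - a\<close> has a root in the spectrum of \<open>X\<close>; so \<open>a\<close> is a value of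
  \<open>p\<close> there.\<close>

lemma op_poly_nonneg:
  fixes X :: "'a :: chilbert_space bounded_op"
  assumes X: "selfadjoint X" and p: "\<And>t. t \<in> real_spectrum X \<Longrightarrow> 0 \<le> poly p t"
  shows "0 \<le> op_poly p X"
proof (cases "(1 :: 'a bounded_op) = 0")
  case True
  then have "op_poly p X = 0"
    by (metis mult_1_left mult_zero_left)
  then show ?thesis
    by simp
next
  case False
  then obtain a where a: "a \<in> real_spectrum (op_poly p X)" "a *\<^sub>R 1 \<le> op_poly p X"
    using real_spectrum_lower[OF selfadjoint_op_poly[OF X]] by blast
  have "\<not> invertible_op (op_poly (p - [:a:]) X)"
    using a(1) by (simp add: in_real_spectrum_iff)
  then obtain t where "t \<in> real_spectrum X" "poly (p - [:a:]) t = 0"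
    using invertible_op_poly[OF X] by blast
  then have "0 \<le> a"
    using p[of t] by simp
  then have "0 \<le> a *\<^sub>R (1 :: 'a bounded_op)"
    by (intro scaleR_nonneg_nonneg) (simp_all add: nonneg_op_iff)
  then show ?thesis
    using a(2) by (rule order_trans)
qed

lemma norm_op_poly_le:
  fixes X :: "'a :: chilbert_space bounded_op"
  assumes X: "selfadjoint X" and "0 \<le> s" and p: "\<And>t. t \<in> real_spectrum X \<Longrightarrow> \<bar>poly p t\<bar> \<le> s"
  shows "norm (op_poly p X) \<le> s"
proof (rule norm_selfadjoint_le[OF selfadjoint_op_poly[OF X] \<open>0 \<le> s\<close>])
  have "0 \<le> poly ([:s:] - p) t" "0 \<le> poly (p - [:- s:]) t" if "t \<in> real_spectrum X" for t
    using p[OF that] by auto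
  then have "0 \<le> op_poly ([:s:] - p) X" "0 \<le> op_poly (p - [:- s:]) X"
    by (intro op_poly_nonneg[OF X]; blast)+
  then show "op_poly p X \<le> s *\<^sub>R 1" "- (s *\<^sub>R 1) \<le> op_poly p X"
    unfolding op_poly_diff diff_ge_0_iff_ge by simp_all
qed


section \<open>Continuous functional calculus\<close>

text \<open>Monotonicity for arbitrary approximating sequences. With \<open>f = g\<close> in both directions it also shows
  that the limit does not depend on the sequence, which makes the description defining \<^const>\<open>cfc\<close>
  proper. Eventually \<open>p\<^sub>n \<le> q\<^sub>n + e\<close> on the spectrum; the inequality passes to the operators, to
  the limit in \<open>n\<close>, and to the limit \<open>e \<rightarrow> 0\<close>.\<close>

lemma op_poly_limit_mono:
  fixes X :: "'a :: chilbert_space bounded_op"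
  assumes X: "selfadjoint X"
    and p: "uniform_limit (real_spectrum X) (\<lambda>n. poly (p n)) f sequentially"
           "(\<lambda>n. op_poly (p n) X) \<longlonglongrightarrow> S"
    and q: "uniform_limit (real_spectrum X) (\<lambda>n. poly (q n)) g sequentially"
           "(\<lambda>n. op_poly (q n) X) \<longlonglongrightarrow> T"
    and le: "\<And>t. t \<in> real_spectrum X \<Longrightarrow> f t \<le> g t"
  shows "S \<le> T"
proof -
  have approx: "S \<le> T + e *\<^sub>R 1" if "0 < e" for e
  proof -
    have "\<forall>\<^sub>F n in sequentially. (\<forall>t\<in>real_spectrum X. dist (poly (p n) t) (f t) < e / 2)
        \<and> (\<forall>t\<in>real_spectrum X. dist (poly (q n) t) (g t) < e / 2)"
      using that by (intro eventually_conj uniform_limitD[OF p(1)] uniform_limitD[OF q(1)]) auto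
    then obtain N where N: "\<And>n t. n \<ge> N \<Longrightarrow> t \<in> real_spectrum X \<Longrightarrow>
        \<bar>poly (p n) t - f t\<bar> < e / 2 \<and> \<bar>poly (q n) t - g t\<bar> < e / 2"
      unfolding eventually_sequentially dist_real_def by blast
    show ?thesis
    proof (rule le_op_closed)
      fix n
      have "0 \<le> op_poly (q (n + N) + [:e:] - p (n + N)) X"
      proof (rule op_poly_nonneg[OF X])
        fix t
        assume t: "t \<in> real_spectrum X"
        show "0 \<le> poly (q (n + N) + [:e:] - p (n + N)) t"
          using conjunct1[OF N[OF le_add2 t]] conjunct2[OF N[OF le_add2 t]] le[OF t]
          unfolding poly_add poly_diff by simp (smt (verit) field_sum_of_halves)
      qed
      then show "op_poly (p (n + N)) X \<le> op_poly (q (n + N)) X + e *\<^sub>R 1"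
        by simp
    next
      show "(\<lambda>n. op_poly (p (n + N)) X) \<longlonglongrightarrow> S"
        using p(2) by (rule LIMSEQ_ignore_initial_segment)
      show "(\<lambda>n. op_poly (q (n + N)) X + e *\<^sub>R 1) \<longlonglongrightarrow> T + e *\<^sub>R 1"
        using q(2) by (intro tendsto_add tendsto_const LIMSEQ_ignore_initial_segment)
    qed
  qed
  show ?thesis
  proof (rule le_op_closed)
    show "S \<le> T + inverse (real (Suc n)) *\<^sub>R 1" for n
      by (rule approx) simp
    have "(\<lambda>n. T + inverse (real (Suc n)) *\<^sub>R 1) \<longlonglongrightarrow> T + 0 *\<^sub>R 1"
      by (intro tendsto_add tendsto_scaleR tendsto_const LIMSEQ_inverse_real_of_nat)
    then show "(\<lambda>n. T + inverse (real (Suc n)) *\<^sub>R 1) \<longlonglongrightarrow> T"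
      by simp
  qed (rule tendsto_const)
qed

lemma cfc_eqI:
  fixes X :: "'a :: chilbert_space bounded_op"
  assumes "selfadjoint X"
    and "uniform_limit (real_spectrum X) (\<lambda>n. poly (p n)) f sequentially"
    and "(\<lambda>n. op_poly (p n) X) \<longlonglongrightarrow> T"
  shows "cfc f X = T"
  unfolding cfc_def real_spectrum_def[symmetric]
proof (rule the_equality)
  show "\<exists>p :: nat \<Rightarrow> real poly. uniform_limit (real_spectrum X) (\<lambda>n. poly (p n)) f sequentially \<and>
      (\<lambda>n. op_poly (p n) X) \<longlonglongrightarrow> T"
    using assms by blast
  fix S
  assume "\<exists>p :: nat \<Rightarrow> real poly. uniform_limit (real_spectrum X) (\<lambda>n. poly (p n)) f sequentially \<and>
      (\<lambda>n. op_poly (p n) X) \<longlonglongrightarrow> S"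
  then show "S = T"
    using assms by (auto intro!: antisym intro: op_poly_limit_mono)
qed

lemma cfc_poly: "selfadjoint X \<Longrightarrow> cfc (poly p) X = op_poly p X"
  by (rule cfc_eqI[where p = "\<lambda>_. p"]) (simp_all add: uniform_limit_const)

lemma weierstrass_poly_sequence:
  fixes f :: "real \<Rightarrow> real"
  assumes "continuous_on {a..b} f"
  obtains p where "uniform_limit {a..b} (\<lambda>n :: nat. poly (p n)) f sequentially"
proof -
  have "\<exists>p. \<forall>t\<in>{a..b}. \<bar>f t - poly p t\<bar> < inverse (real (Suc n))" for n
  proof -
    obtain g where g: "real_polynomial_function g"
        "\<And>t. t \<in> {a..b} \<Longrightarrow> \<bar>f t - g t\<bar> < inverse (real (Suc n))"
      using Stone_Weierstrass_real_polynomial_function[of "{a..b}" f "inverse (real (Suc n))"] assms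
      by auto
    then obtain c k where "g = (\<lambda>t. \<Sum>i\<le>k. c i * t ^ i)"
      by (auto simp: real_polynomial_function_iff_sum)
    then have "g = poly (\<Sum>i\<le>k. monom (c i) i)"
      by (simp add: poly_sum poly_monom fun_eq_iff)
    with g(2) show ?thesis
      by blast
  qed
  then obtain p where p: "\<And>n t. t \<in> {a..b} \<Longrightarrow> \<bar>f t - poly (p n) t\<bar> < inverse (real (Suc n))"
    by metis
  have "uniform_limit {a..b} (\<lambda>n. poly (p n)) f sequentially"
  proof (rule uniform_limitI)
    fix e :: real
    assume "0 < e"
    then have "\<forall>\<^sub>F n in sequentially. inverse (real (Suc n)) < e"
      by (rule order_tendstoD[OF LIMSEQ_inverse_real_of_nat])
    then show "\<forall>\<^sub>F n in sequentially. \<forall>t\<in>{a..b}. dist (poly (p n) t) (f t) < e"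
    proof eventually_elim
      case (elim n)
      then show ?case
        using p[of _ n] by (force simp: dist_real_def abs_minus_commute)
    qed
  qed
  then show ?thesis
    by (rule that)
qed

lemma op_poly_convergent:
  fixes X :: "'a :: chilbert_space bounded_op"
  assumes X: "selfadjoint X"
    and p: "uniform_limit (real_spectrum X) (\<lambda>n. poly (p n)) f sequentially"
  shows "convergent (\<lambda>n. op_poly (p n) X)"
proof (rule Cauchy_convergent, rule CauchyI)
  fix e :: real
  assume e: "0 < e"
  then have "\<forall>\<^sub>F n in sequentially. \<forall>t\<in>real_spectrum X. dist (poly (p n) t) (f t) < e / 4"
    by (intro uniform_limitD[OF p]) simp
  then obtain N where N: "\<And>n t. n \<ge> N \<Longrightarrow> t \<in> real_spectrum X \<Longrightarrow> \<bar>poly (p n) t - f t\<bar> < e / 4"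
    unfolding eventually_sequentially dist_real_def by blast
  show "\<exists>N. \<forall>m\<ge>N. \<forall>n\<ge>N. norm (op_poly (p m) X - op_poly (p n) X) < e"
  proof (intro exI[of _ N] allI impI)
    fix m n
    assume "m \<ge> N" "n \<ge> N"
    have "norm (op_poly (p m - p n) X) \<le> e / 2"
    proof (rule norm_op_poly_le[OF X])
      fix t
      assume "t \<in> real_spectrum X"
      then show "\<bar>poly (p m - p n) t\<bar> \<le> e / 2"
        using N[OF \<open>m \<ge> N\<close>, of t] N[OF \<open>n \<ge> N\<close>, of t] unfolding poly_diff by linarith
    qed (use e in simp)
    then show "norm (op_poly (p m) X - op_poly (p n) X) < e"
      using e by simp
  qed
qed

text \<open>The interval provides approximating polynomials, by the Weierstrass theorem.\<close>

lemma cfc_mono: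
  fixes X :: "'a :: chilbert_space bounded_op"
  assumes X: "selfadjoint X" and spec: "real_spectrum X \<subseteq> {a..b}"
    and cont: "continuous_on {a..b} f" "continuous_on {a..b} g"
    and le: "\<And>t. t \<in> real_spectrum X \<Longrightarrow> f t \<le> g t"
  shows "cfc f X \<le> cfc g X"
proof -
  obtain p q where pq: "uniform_limit {a..b} (\<lambda>n. poly (p n)) f sequentially"
      "uniform_limit {a..b} (\<lambda>n. poly (q n)) g sequentially"
    using cont by (metis weierstrass_poly_sequence)
  note pq = uniform_limit_on_subset[OF pq(1) spec] uniform_limit_on_subset[OF pq(2) spec]
  obtain S T where ST: "(\<lambda>n. op_poly (p n) X) \<longlonglongrightarrow> S" "(\<lambda>n. op_poly (q n) X) \<longlonglongrightarrow> T"
    using op_poly_convergent[OF X pq(1)] op_poly_convergent[OF X pq(2)]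
    by (auto simp: convergent_def)
  have "S \<le> T"
    using X pq(1) ST(1) pq(2) ST(2) le by (rule op_poly_limit_mono)
  then show ?thesis
    using cfc_eqI[OF X pq(1) ST(1)] cfc_eqI[OF X pq(2) ST(2)] by simp
qed


section \<open>Scalar inequalities for log-convex functions\<close>

text \<open>For \<open>s \<le> 0\<close> the point \<open>x\<close> lies between \<open>y\<close> and the extrapolated point, and convexity there
  reads as a lower bound for \<open>g\<close> at the latter.\<close>

lemma convex_on_extrapolation:
  fixes g :: "real \<Rightarrow> real"
  assumes "convex_on J g" "x \<in> J" "y \<in> J" "(1 - s) * x + s * y \<in> J" "s \<le> 0"
  shows "(1 - s) * g x + s * g y \<le> g ((1 - s) * x + s * y)"
proof -
  define z where "z = (1 - s) * x + s * y"
  \<comment> \<open>The weight \<open>u\<close> solves \<open>x = (1 - u) z + u y\<close>.\<close>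
  define u where "u = - s / (1 - s)"
  have u: "0 \<le> u" "u \<le> 1" "(1 - s) * (1 - u) = 1" "(1 - s) * u = - s"
    using assms(5) by (simp_all add: u_def field_simps)
  have "(1 - s) * ((1 - u) * z + u * y) = ((1 - s) * (1 - u)) * z + ((1 - s) * u) * y"
    by (simp add: algebra_simps)
  then have "(1 - s) * ((1 - u) * z + u * y) = (1 - s) * x"
    by (simp add: u z_def)
  then have x: "(1 - u) * z + u * y = x"
    using assms(5) by simp
  have "g ((1 - u) *\<^sub>R z + u *\<^sub>R y) \<le> (1 - u) * g z + u * g y"
    using assms(3,4) u by (intro convex_onD[OF assms(1)]) (auto simp: z_def)
  then have "(1 - s) * g x \<le> (1 - s) * ((1 - u) * g z + u * g y)"
    using assms(5) x by (intro mult_left_mono) auto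
  also have "\<dots> = ((1 - s) * (1 - u)) * g z + ((1 - s) * u) * g y"
    by (simp add: algebra_simps)
  finally show ?thesis
    by (simp add: u z_def)
qed

text \<open>\<^term>\<open>ln (refined_interp f m M t)\<close> is the chord of \<open>ln \<circ> f\<close> over \<open>{m..M}\<close> plus a multiple of
  \<^term>\<open>tilde m M t\<close>, whose factor, the logarithm of \<^term>\<open>K_const f m M\<close>, is nonpositive for
  log-convex \<open>f\<close>. On either side of the midpoint \<open>\<mu>\<close> it is affine, and it agrees with \<open>ln \<circ> f\<close> at
  \<open>m\<close>, \<open>\<mu>\<close> and \<open>M\<close>.\<close>

locale log_convex_interval =
  fixes J :: "real set" and f :: "real \<Rightarrow> real" and m M :: real
  assumes log_convex: "log_convex_on J f" and interval: "is_interval J"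
    and in_J: "m \<in> J" "M \<in> J" and less: "m < M"
begin

definition \<mu> :: real
  where "\<mu> = (m + M) / 2"

lemma mid_in_J: "\<mu> \<in> J"
  by (rule mem_is_interval_1_I[OF interval in_J]) (use less in \<open>simp_all add: \<mu>_def\<close>)

lemma pos: "t \<in> J \<Longrightarrow> 0 < f t"
  using log_convex by (simp add: log_convex_on_def)

lemma convex_ln: "convex_on J (\<lambda>t. ln (f t))"
  using log_convex by (simp add: log_convex_on_def)

lemma refined_interp_eq_exp:
  defines "r \<equiv> \<lambda>t. (t - m) / (M - m)"
  shows "refined_interp f m M t = exp (tilde m M t * (2 * ln (f \<mu>) - ln (f m) - ln (f M))
    + ((1 - r t) * ln (f m) + r t * ln (f M)))"
proof -
  have "(M - t) / (M - m) = 1 - r t"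
    using less by (simp add: r_def field_simps)
  moreover have "0 < f m" "0 < f M" "0 < f \<mu>"
    using pos in_J mid_in_J by auto
  moreover from this have "ln (K_const f m M) = 2 * ln (f \<mu>) - ln (f m) - ln (f M)"
    by (simp add: K_const_def \<mu>_def ln_div ln_mult ln_realpow)
  moreover have "K_const f m M \<noteq> 0"
    using \<open>0 < f m\<close> \<open>0 < f M\<close> \<open>0 < f \<mu>\<close> by (simp add: K_const_def \<mu>_def)
  ultimately show ?thesis
    by (simp add: refined_interp_def powr_def r_def exp_add)
qed

lemma refined_interp_pos: "0 < refined_interp f m M t"
  by (simp only: refined_interp_eq_exp exp_gt_zero)

lemma refined_interp_left:
  assumes "t \<le> \<mu>"
  defines "s \<equiv> (t - m) / (\<mu> - m)"
  shows "refined_interp f m M t = exp ((1 - s) * ln (f m) + s * ln (f \<mu>))"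
    and "t = (1 - s) * m + s * \<mu>"
proof -
  define r where "r = (t - m) / (M - m)"
  have s: "s = 2 * r"
    using less by (simp add: s_def \<mu>_def r_def field_simps)
  have "tilde m M t = r"
    using assms(1) less by (simp add: tilde_def \<mu>_def r_def field_simps)
  then show "refined_interp f m M t = exp ((1 - s) * ln (f m) + s * ln (f \<mu>))"
    by (simp only: refined_interp_eq_exp s r_def[symmetric]) (simp add: algebra_simps)
  have "s * (\<mu> - m) = t - m"
    using less by (simp add: s_def \<mu>_def)
  then show "t = (1 - s) * m + s * \<mu>"
    by (simp add: algebra_simps)
qed

lemma refined_interp_right:
  assumes "\<mu> \<le> t"
  defines "s \<equiv> (M - t) / (M - \<mu>)"
  shows "refined_interp f m M t = exp ((1 - s) * ln (f M) + s * ln (f \<mu>))"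
    and "t = (1 - s) * M + s * \<mu>"
proof -
  define r where "r = (t - m) / (M - m)"
  have s: "s = 2 * (1 - r)"
    using less by (simp add: s_def \<mu>_def r_def field_simps)
  have "tilde m M t = 1 - r"
    using assms(1) less by (simp add: tilde_def \<mu>_def r_def field_simps)
  then show "refined_interp f m M t = exp ((1 - s) * ln (f M) + s * ln (f \<mu>))"
    by (simp only: refined_interp_eq_exp s r_def[symmetric]) (simp add: algebra_simps)
  have "s * (M - \<mu>) = M - t"
    using less by (simp add: s_def \<mu>_def)
  then show "t = (1 - s) * M + s * \<mu>"
    by (simp add: algebra_simps)
qed

lemma le_refined_interp:
  assumes "t \<in> {m..M}"
  shows "f t \<le> refined_interp f m M t"
proof -
  have J: "t \<in> J"
    using assms by (auto intro: mem_is_interval_1_I[OF interval in_J])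
  have "ln (f t) \<le> ln (refined_interp f m M t)"
  proof (cases "t \<le> \<mu>")
    case True
    define s where "s = (t - m) / (\<mu> - m)"
    have "0 \<le> s" "s \<le> 1"
      using True assms less by (simp_all add: s_def \<mu>_def field_simps)
    then show ?thesis
      using convex_onD[OF convex_ln, of s m \<mu>] in_J mid_in_J refined_interp_left[OF True]
      by (simp add: s_def)
  next
    case False
    then have t: "\<mu> \<le> t"
      by simp
    define s where "s = (M - t) / (M - \<mu>)"
    have "0 \<le> s" "s \<le> 1"
      using t assms less by (simp_all add: s_def \<mu>_def field_simps)
    then show ?thesis
      using convex_onD[OF convex_ln, of s M \<mu>] in_J mid_in_J refined_interp_right[OF t]
      by (simp add: s_def)
  qed
  then show ?thesis
    using pos[OF J] refined_interp_pos by (simp only: ln_le_cancel_iff)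
qed

lemma refined_interp_le:
  assumes "t \<in> J" "t \<le> m \<or> M \<le> t"
  shows "refined_interp f m M t \<le> f t"
proof -
  have "ln (refined_interp f m M t) \<le> ln (f t)"
  proof (cases "t \<le> m")
    case True
    then have t: "t \<le> \<mu>"
      using less by (simp add: \<mu>_def)
    define s where "s = (t - m) / (\<mu> - m)"
    have "s \<le> 0"
      using True less by (simp add: s_def \<mu>_def field_simps)
    then show ?thesis
      using convex_on_extrapolation[OF convex_ln, of m \<mu> s] in_J mid_in_J
        refined_interp_left[OF t] assms(1)
      by (simp add: s_def)
  next
    case False
    then have t: "\<mu> \<le> t" "M \<le> t"
      using assms(2) less by (simp_all add: \<mu>_def)
    define s where "s = (M - t) / (M - \<mu>)"
    have "s \<le> 0"
      using t(2) less by (simp add: s_def \<mu>_def field_simps)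
    then show ?thesis
      using convex_on_extrapolation[OF convex_ln, of M \<mu> s] in_J mid_in_J
        refined_interp_right[OF t(1)] assms(1)
      by (simp add: s_def)
  qed
  then show ?thesis
    using pos[OF assms(1)] refined_interp_pos by (simp only: ln_le_cancel_iff)
qed

text \<open>The chord of \<open>f\<close> through \<open>m\<close> and \<open>M\<close>, as a polynomial, so that its functional calculus is
  given by polynomial evaluation.\<close>

definition chord :: "real poly"
  where "chord = smult (f m / (M - m)) [:M, - 1:] + smult (f M / (M - m)) [:- m, 1:]"

text \<open>Writing \<open>f m\<close> and \<open>f M\<close> as exponentials turns the comparison of the chord of \<open>f\<close> with the
  exponential of the chord of \<open>ln \<circ> f\<close> into the convexity of \<open>exp\<close>.\<close>

lemma poly_chord:
  defines "r \<equiv> \<lambda>t. (t - m) / (M - m)"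
  shows "poly chord t = (1 - r t) * exp (ln (f m)) + r t * exp (ln (f M))"
proof -
  have "(M - t) / (M - m) = 1 - r t"
    using less by (simp add: r_def field_simps)
  moreover have "poly chord t = (M - t) / (M - m) * f m + (t - m) / (M - m) * f M"
    by (simp add: chord_def diff_divide_distrib algebra_simps)
  ultimately show ?thesis
    using pos in_J by (simp add: r_def)
qed

lemma log_midpoint_le: "2 * ln (f \<mu>) - ln (f m) - ln (f M) \<le> 0"
proof -
  have "ln (f ((1 - 1 / 2) *\<^sub>R m + (1 / 2) *\<^sub>R M)) \<le> (1 - 1 / 2) * ln (f m) + 1 / 2 * ln (f M)"
    using in_J by (intro convex_onD[OF convex_ln]) auto
  moreover have "(1 - 1 / 2) *\<^sub>R m + (1 / 2) *\<^sub>R M = \<mu>"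
    by (simp add: \<mu>_def field_simps)
  ultimately show ?thesis
    by simp
qed

lemma refined_interp_le_chord:
  assumes "t \<in> {m..M}"
  shows "refined_interp f m M t \<le> poly chord t"
proof -
  define r where "r = (t - m) / (M - m)"
  have r: "0 \<le> r" "r \<le> 1"
    using assms less by (simp_all add: r_def)
  have "\<bar>t - (m + M) / 2\<bar> \<le> (M - m) / 2"
    using assms by (auto simp: abs_le_iff field_simps)
  then have "0 \<le> tilde m M t"
    using less by (simp add: tilde_def field_simps)
  then have "tilde m M t * (2 * ln (f \<mu>) - ln (f m) - ln (f M)) \<le> 0"
    using log_midpoint_le by (rule mult_nonneg_nonpos)
  then have "refined_interp f m M t \<le> exp ((1 - r) * ln (f m) + r * ln (f M))"
    by (simp add: refined_interp_eq_exp r_def)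
  also have "\<dots> \<le> (1 - r) * exp (ln (f m)) + r * exp (ln (f M))"
    using convex_onD[OF exp_convex r] by simp
  finally show ?thesis
    by (simp only: poly_chord r_def)
qed

lemma chord_le_refined_interp:
  assumes "t \<le> m \<or> M \<le> t"
  shows "poly chord t \<le> refined_interp f m M t"
proof -
  define r where "r = (t - m) / (M - m)"
  have "poly chord t = (1 - r) * exp (ln (f m)) + r * exp (ln (f M))"
    by (simp only: poly_chord r_def)
  also have "\<dots> \<le> exp ((1 - r) * ln (f m) + r * ln (f M))"
  proof (cases "t \<le> m")
    case True
    then have "r \<le> 0"
      using less by (simp add: r_def field_simps)
    then show ?thesis
      by (intro convex_on_extrapolation[OF exp_convex]) auto
  next
    case False
    then have "1 - r \<le> 0"
      using less assms by (simp add: r_def field_simps)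
    then show ?thesis
      using convex_on_extrapolation[OF exp_convex, of "ln (f M)" "ln (f m)" "1 - r"]
      by (simp add: add.commute)
  qed
  also have "\<dots> \<le> refined_interp f m M t"
  proof -
    have "tilde m M t \<le> 0"
      using assms less by (auto simp: tilde_def field_simps abs_if)
    then have "0 \<le> tilde m M t * (2 * ln (f \<mu>) - ln (f m) - ln (f M))"
      using log_midpoint_le by (rule mult_nonpos_nonpos)
    then show ?thesis
      by (simp add: refined_interp_eq_exp r_def)
  qed
  finally show ?thesis .
qed

lemma continuous_refined_interp: "continuous_on S (refined_interp f m M)"
  unfolding refined_interp_eq_exp tilde_def using less by (intro continuous_intros) auto

end


section \<open>Positive unital maps\<close>

locale positive_unital_map =
  fixes \<Phi> :: "'a :: complex_inner bounded_op \<Rightarrow> 'b :: complex_inner bounded_op"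
  assumes linear: "clinear \<Phi>" and positive: "positive_map \<Phi>" and unital: "unital_map \<Phi>"
begin

lemma map_add: "\<Phi> (X + Y) = \<Phi> X + \<Phi> Y"
  using linear by (simp add: clinear_iff)

lemma map_scaleR: "\<Phi> (r *\<^sub>R X) = r *\<^sub>R \<Phi> X"
  using linear by (simp add: clinear_iff scaleR_scaleC)

lemma map_one: "\<Phi> 1 = 1"
  using unital by (simp add: unital_map_def)

lemma map_diff: "\<Phi> (X - Y) = \<Phi> X - \<Phi> Y"
  using map_add[of X "(- 1) *\<^sub>R Y"] unfolding map_scaleR by simp

lemma map_mono: "X \<le> Y \<Longrightarrow> \<Phi> X \<le> \<Phi> Y"
  using positive map_diff[of Y X] unfolding positive_map_def by (metis diff_ge_0_iff_ge)

text \<open>A self-adjoint operator is the difference of a positive operator and a multiple of the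
  identity.\<close>

lemma map_selfadjoint:
  assumes "selfadjoint X"
  shows "selfadjoint (\<Phi> X)"
proof -
  have "0 \<le> X + norm X *\<^sub>R 1"
    using selfadjoint_bounds(2)[OF assms] by (metis diff_ge_0_iff_ge diff_minus_eq_add scaleR_minus_left)
  then have "0 \<le> \<Phi> (X + norm X *\<^sub>R 1)"
    using positive by (simp add: positive_map_def)
  then have "selfadjoint (\<Phi> (X + norm X *\<^sub>R 1) - norm X *\<^sub>R 1)"
    by (auto simp: nonneg_op_iff)
  then show ?thesis
    by (simp add: map_add map_scaleR map_one)
qed

lemma map_bounds:
  shows "c *\<^sub>R 1 \<le> X \<Longrightarrow> c *\<^sub>R 1 \<le> \<Phi> X" "X \<le> c *\<^sub>R 1 \<Longrightarrow> \<Phi> X \<le> c *\<^sub>R 1"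
  using map_mono[of "c *\<^sub>R 1" X] map_mono[of X "c *\<^sub>R 1"] by (simp_all add: map_scaleR map_one)

end

theorem theorem2p6:
  fixes J :: "real set" and f :: "real \<Rightarrow> real" and m M :: real
    and A B C D :: "'a :: chilbert_space bounded_op"
    and \<Phi> :: "'a bounded_op \<Rightarrow> 'a bounded_op"
  assumes "is_interval J"
    and "continuous_on J f"
    and "log_convex_on J f"
    and "selfadjoint A" "selfadjoint B" "selfadjoint C" "selfadjoint D"
    and "spectrum A \<subseteq> complex_of_real ` J" "spectrum B \<subseteq> complex_of_real ` J"
        "spectrum C \<subseteq> complex_of_real ` J" "spectrum D \<subseteq> complex_of_real ` J"
    and "A + D = B + C"
    and "m < M"
    and "A \<le> m *\<^sub>R 1" "m *\<^sub>R 1 \<le> B" "B \<le> M *\<^sub>R 1" "M *\<^sub>R 1 \<le> D"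
    and "m *\<^sub>R 1 \<le> C" "C \<le> M *\<^sub>R 1"
    and "clinear \<Phi>" "positive_map \<Phi>" "unital_map \<Phi>"
  shows "\<Phi> (cfc f B) + \<Phi> (cfc f C)
           \<le> \<Phi> (cfc (refined_interp f m M) B) + \<Phi> (cfc (refined_interp f m M) C) \<and>
         \<Phi> (cfc (refined_interp f m M) B) + \<Phi> (cfc (refined_interp f m M) C)
           \<le> (f m / (M - m)) *\<^sub>R ((2 * M) *\<^sub>R 1 - \<Phi> (B + C))
             + (f M / (M - m)) *\<^sub>R (\<Phi> (B + C) - (2 * m) *\<^sub>R 1) \<and>
         (f m / (M - m)) *\<^sub>R ((2 * M) *\<^sub>R 1 - \<Phi> (B + C))
             + (f M / (M - m)) *\<^sub>R (\<Phi> (B + C) - (2 * m) *\<^sub>R 1)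
           \<le> cfc (refined_interp f m M) (\<Phi> A) + cfc (refined_interp f m M) (\<Phi> D) \<and>
         cfc (refined_interp f m M) (\<Phi> A) + cfc (refined_interp f m M) (\<Phi> D)
           \<le> cfc f (\<Phi> A) + cfc f (\<Phi> D)"
proof (cases "(1 :: 'a bounded_op) = 0")
  case True
  \<comment> \<open>On the zero space \<open>J\<close> may be empty, but all operators coincide.\<close>
  have eq: "S = T" for S T :: "'a bounded_op"
    using True by (metis mult_1_left mult_zero_left)
  show ?thesis
    by (intro conjI; rule eq_refl; rule eq)
next
  case False
  interpret positive_unital_map \<Phi>
    by (rule positive_unital_map.intro; fact assms)
  \<comment> \<open>The points \<open>a\<close> and \<open>b\<close> belong to \<open>J\<close> and enclose all spectra that occur; by \<open>a \<le> m < M \<le> b\<close>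
    the interval \<open>J\<close> contains \<open>m\<close> and \<open>M\<close> as well.\<close>
  obtain a where a: "a \<in> real_spectrum A" "a *\<^sub>R 1 \<le> A"
    using real_spectrum_lower[OF \<open>selfadjoint A\<close> False] .
  obtain b where b: "b \<in> real_spectrum D" "D \<le> b *\<^sub>R 1"
    using real_spectrum_upper[OF \<open>selfadjoint D\<close> False] .
  have J: "a \<in> J" "b \<in> J"
    using a b assms(8,11) real_spectrum_subset by blast+
  have ab: "a \<le> m" "M \<le> b"
    using a b real_spectrum_le[OF \<open>selfadjoint A\<close> \<open>A \<le> m *\<^sub>R 1\<close>]
      real_spectrum_ge[OF \<open>selfadjoint D\<close> \<open>M *\<^sub>R 1 \<le> D\<close>] by auto
  have sub: "{a..b} \<subseteq> J"
    by (auto intro: mem_is_interval_1_I[OF assms(1) J])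
  interpret log_convex_interval J f m M
    by standard (use assms(1,3,13) sub ab in auto)
  have cont: "continuous_on {a..b} f" "continuous_on {a..b} (refined_interp f m M)"
      "continuous_on {a..b} (poly chord)"
    using continuous_on_subset[OF assms(2) sub] continuous_refined_interp
    by (auto intro: continuous_intros)
  have chord: "cfc (poly chord) X
      = (f m / (M - m)) *\<^sub>R (M *\<^sub>R 1 - X) + (f M / (M - m)) *\<^sub>R (X - m *\<^sub>R 1)"
    if "selfadjoint X" for X :: "'a bounded_op"
    unfolding cfc_poly[OF that] chord_def op_poly_add op_poly_smult by simp
  have inner: "\<Phi> (cfc f X) \<le> \<Phi> (cfc (refined_interp f m M) X)"
      "\<Phi> (cfc (refined_interp f m M) X) \<le> \<Phi> (cfc (poly chord) X)"
    if X: "selfadjoint X" "m *\<^sub>R 1 \<le> X" "X \<le> M *\<^sub>R 1" for X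
  proof -
    have spec: "real_spectrum X \<subseteq> {m..M}"
      using real_spectrum_ge[OF X(1,2)] real_spectrum_le[OF X(1,3)] by auto
    then have spec': "real_spectrum X \<subseteq> {a..b}"
      using ab by auto
    show "\<Phi> (cfc f X) \<le> \<Phi> (cfc (refined_interp f m M) X)"
      by (intro map_mono cfc_mono[OF X(1) spec' cont(1,2)] le_refined_interp) (use spec in blast)
    show "\<Phi> (cfc (refined_interp f m M) X) \<le> \<Phi> (cfc (poly chord) X)"
      by (intro map_mono cfc_mono[OF X(1) spec' cont(2,3)] refined_interp_le_chord)
        (use spec in blast)
  qed
  have outer: "cfc (poly chord) X \<le> cfc (refined_interp f m M) X"
      "cfc (refined_interp f m M) X \<le> cfc f X"
    if X: "selfadjoint X" "real_spectrum X \<subseteq> {a..m} \<union> {M..b}" for X :: "'a bounded_op"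
  proof -
    have spec: "real_spectrum X \<subseteq> {a..b}"
      using X(2) ab less by fastforce
    show "cfc (poly chord) X \<le> cfc (refined_interp f m M) X"
      by (intro cfc_mono[OF X(1) spec cont(3,2)] chord_le_refined_interp) (use X(2) in auto)
    show "cfc (refined_interp f m M) X \<le> cfc f X"
      by (intro cfc_mono[OF X(1) spec cont(2,1)] refined_interp_le) (use X(2) spec sub in auto)
  qed
  have self: "selfadjoint (\<Phi> A)" "selfadjoint (\<Phi> D)"
    by (simp_all add: map_selfadjoint assms)
  have "real_spectrum (\<Phi> A) \<subseteq> {a..} \<inter> {..m}"
    using real_spectrum_ge[OF self(1) map_bounds(1)[OF a(2)]]
      real_spectrum_le[OF self(1) map_bounds(2)[OF \<open>A \<le> m *\<^sub>R 1\<close>]] by blast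
  then have specA: "real_spectrum (\<Phi> A) \<subseteq> {a..m} \<union> {M..b}"
    by auto
  have "real_spectrum (\<Phi> D) \<subseteq> {M..} \<inter> {..b}"
    using real_spectrum_ge[OF self(2) map_bounds(1)[OF \<open>M *\<^sub>R 1 \<le> D\<close>]]
      real_spectrum_le[OF self(2) map_bounds(2)[OF b(2)]] by blast
  then have specD: "real_spectrum (\<Phi> D) \<subseteq> {a..m} \<union> {M..b}"
    by auto
  define mid where "mid = (f m / (M - m)) *\<^sub>R ((2 * M) *\<^sub>R 1 - \<Phi> (B + C))
    + (f M / (M - m)) *\<^sub>R (\<Phi> (B + C) - (2 * m) *\<^sub>R 1)"
  \<comment> \<open>The chord is affine, so its values at two operators depend only on their sum.\<close>
  have affine: "(u *\<^sub>R (M *\<^sub>R 1 - X) + v *\<^sub>R (X - m *\<^sub>R 1)) + (u *\<^sub>R (M *\<^sub>R 1 - Y) + v *\<^sub>R (Y - m *\<^sub>R 1))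
      = u *\<^sub>R ((2 * M) *\<^sub>R 1 - (X + Y)) + v *\<^sub>R ((X + Y) - (2 * m) *\<^sub>R 1)"
    for u v and X Y :: "'a bounded_op"
  proof -
    have "(2 * c) *\<^sub>R (1 :: 'a bounded_op) = c *\<^sub>R 1 + c *\<^sub>R 1" for c
      by (simp flip: scaleR_left_distrib)
    then show ?thesis
      by (simp add: algebra_simps)
  qed
  have mid_inner: "\<Phi> (cfc (poly chord) B) + \<Phi> (cfc (poly chord) C) = mid"
    using assms(5,6)
    by (simp only: chord map_add map_diff map_scaleR map_one mid_def affine)
  have "\<Phi> B + \<Phi> C = \<Phi> A + \<Phi> D"
    using assms(12) by (simp flip: map_add)
  then have mid_outer: "cfc (poly chord) (\<Phi> A) + cfc (poly chord) (\<Phi> D) = mid"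
    using self by (simp only: chord map_add mid_def affine)
  have "\<Phi> (cfc f B) + \<Phi> (cfc f C)
      \<le> \<Phi> (cfc (refined_interp f m M) B) + \<Phi> (cfc (refined_interp f m M) C)"
    using assms by (intro add_mono inner)
  moreover have "\<Phi> (cfc (refined_interp f m M) B) + \<Phi> (cfc (refined_interp f m M) C) \<le> mid"
    unfolding mid_inner[symmetric] using assms by (intro add_mono inner)
  moreover have "mid \<le> cfc (refined_interp f m M) (\<Phi> A) + cfc (refined_interp f m M) (\<Phi> D)"
    unfolding mid_outer[symmetric] using self specA specD by (intro add_mono outer)
  moreover have "cfc (refined_interp f m M) (\<Phi> A) + cfc (refined_interp f m M) (\<Phi> D)
      \<le> cfc f (\<Phi> A) + cfc f (\<Phi> D)"
    using self specA specD by (intro add_mono outer)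
  ultimately show ?thesis
    by (simp only: mid_def)
qed

end
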